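(* Let $\mathbb{I}$ be $\mathbb{Q}$ or an imaginary quadratic field, with ring of integers $\mathbb{Z}_{\mathbb{I}}$, and let $m\ge 2$ be an integer. For $\overline{\beta}=(\beta_0,\beta_1,\dots,\beta_m)^T\in\mathbb{Z}_{\mathbb{I}}^{m+1}\setminus\{\overline 0\}$ put $h_i=\max\{1,|\beta_i|\}$ for $1\le i\le m$ and $h=h_1h_2\cdots h_m$. If $$\log h\ \ge\ m^2\bigl(41\log(m+1)+10\bigr)\,e^{m^2(81\log(m+1)+20)},$$ then $$\left|\beta_0+\beta_1 e+\beta_2 e^{2}+\cdots+\beta_m e^{m}\right|>\frac{1}{h^{1+\hat\epsilon(h)}},\qquad \hat\epsilon(h)=\frac{(4+7m)\sqrt{\log(m+1)}}{\sqrt{\log\log h}} .$$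
   Context: $|\cdot|$ is the usual complex absolute value, and $\mathbb{I}$ is regarded as a subfield of $\mathbb{C}$. *)

theory Defs
  imports "HOL-Analysis.Analysis" "HOL-Computational_Algebra.Computational_Algebra"
begin

definition subfield_of_complex :: "complex set \<Rightarrow> bool" where
  "subfield_of_complex K \<longleftrightarrow>
     0 \<in> K \<and> 1 \<in> K \<and>
     (\<forall>x\<in>K. \<forall>y\<in>K. x - y \<in> K \<and> x * y \<in> K) \<and>
     (\<forall>x\<in>K. x \<noteq> 0 \<longrightarrow> inverse x \<in> K)"

global_interpretation rat_complex: vector_space "\<lambda>(q::rat) (z::complex). of_rat q * z"
  by unfold_locales (simp_all add: algebra_simps of_rat_add of_rat_mult)

(* dim is 0 for infinite-dimensional spaces, so dim K = 2 does imply finite degree. *)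
definition imaginary_quadratic_field :: "complex set \<Rightarrow> bool" where
  "imaginary_quadratic_field K \<longleftrightarrow>
     subfield_of_complex K \<and> rat_complex.dim K = 2 \<and> \<not> K \<subseteq> \<real>"

definition ring_of_integers :: "complex set \<Rightarrow> complex set" where
  "ring_of_integers K = {x \<in> K. algebraic_int x}"

definition height :: "nat \<Rightarrow> (nat \<Rightarrow> complex) \<Rightarrow> real" where
  "height m \<beta> = (\<Prod>i=1..m. max 1 (cmod (\<beta> i)))"

definition epsilon_hat :: "nat \<Rightarrow> real \<Rightarrow> real" where
  "epsilon_hat m h = (4 + 7 * real m) * sqrt (ln (real m + 1)) / sqrt (ln (ln h))"

end

(*
  A Hermite-Pade argument of the second kind. Siegel's lemma gives integers c_0, ..., c_N, not all 0
  and not too large, such that for A(x) = N! sum_k c_k x^k/k! and 1 <= j <= m the power series of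
  A(x) e^(jx) has a gap of length nu_j after degree N. Truncating at degree N and evaluating
  derivatives at x = 1 yields integers b_0, ..., b_m with |b_0 e^j - b_j| about N^(-nu_j) and |b_0|
  about N!. By a Wronskian zero estimate, one of the first N - sum nu_j + m^2 derivatives gives
  sum beta_j b_j <> 0; this is an integer of K, so it has absolute value at least 1. When
  N^(nu_j) slightly exceeds h_j, the terms beta_j (b_0 e^j - b_j) are negligible in
    b_0 (sum beta_j e^j) = sum beta_j b_j + sum beta_j (b_0 e^j - b_j),
  so |sum beta_j e^j| is at least about 1/N!, where N! is close to h because sum nu_j is close to N.
*)
theory Submission
  imports Defs "Jordan_Normal_Form.Char_Poly"
begin

section \<open>Integers of imaginary quadratic fields\<close>

text \<open>Giving each j its own gap length lets the bound depend on the product of the h_j and not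
  on their maximum. With gaps of total length N, Siegel's lemma would keep a single free unknown and
  its solution could be of size exp(const * N^2), which swamps N!. So about \<gamma> * N unknowns
  stay free, which brings the size down to about exp(2 * N * ln(m+1) / \<gamma>). But the zero
  estimate must then allow \<gamma> * N + m^2 derivatives, and each derivative shortens all m gaps
  by one. Relative to N, the gaps lose about (m+1) * \<gamma> to freedom and differentiation, and 2
  * m * ln(m+1) / (\<gamma> * ln N) to the size of the coefficients. These balance when \<gamma> is
  of order sqrt(ln(m+1) / ln N). Since ln N is close to ln ln h, this is the origin of the square
  roots in the final exponent.\<close>

lemma complex_of_rat_eq_of_real: "(of_rat r :: complex) = of_real (of_rat r)"
  by (cases r) (simp add: of_rat_rat)

lemma subfield_of_complexD:
  assumes "subfield_of_complex K"
  shows "0 \<in> K" "1 \<in> K" "x \<in> K \<Longrightarrow> y \<in> K \<Longrightarrow> x - y \<in> K" "x \<in> K \<Longrightarrow> y \<in> K \<Longrightarrow> x * y \<in> K"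
    "x \<in> K \<Longrightarrow> y \<in> K \<Longrightarrow> x + y \<in> K"
proof -
  show base: "0 \<in> K" "1 \<in> K" "x \<in> K \<Longrightarrow> y \<in> K \<Longrightarrow> x - y \<in> K" "x \<in> K \<Longrightarrow> y \<in> K \<Longrightarrow> x * y \<in> K" for x y
    using assms by (auto simp: subfield_of_complex_def)
  show "x + y \<in> K" if "x \<in> K" "y \<in> K"
    using base(3)[OF that(1) base(3)[OF base(1) that(2)]] by simp
qed

lemma Rats_subset_subfield:
  assumes "subfield_of_complex K"
  shows "\<rat> \<subseteq> K"
proof
  note K = subfield_of_complexD[OF assms]
  have nat: "of_nat n \<in> K" for n
    by (induction n) (auto intro: K)
  have int: "of_int z \<in> K" for z
    using nat[of "nat z"] K(3)[OF K(1) nat[of "nat (-z)"]] by (cases "z \<ge> 0") auto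
  fix x :: complex assume "x \<in> \<rat>"
  then obtain a b where "b > 0" "x = of_int a / of_int b"
    by (auto elim: Rats_cases')
  then show "x \<in> K"
    using int assms by (auto simp: subfield_of_complex_def divide_inverse)
qed

text \<open>Since \<open>y\<close> is not real, \<open>1\<close> and \<open>y\<close> are
  independent over the rationals; an element outside their span would give three independent vectors
  in a space spanned by two.\<close>

lemma imaginary_quadratic_obtain_coordinates:
  assumes "imaginary_quadratic_field K" and x: "x \<in> K" and y: "y \<in> K" "y \<notin> \<real>"
  obtains p q :: rat where "x = of_rat p + of_rat q * y"
proof -
  have K: "subfield_of_complex K" and dim: "rat_complex.dim K = 2"
    using assms(1) by (auto simp: imaginary_quadratic_field_def)
  have sub: "rat_complex.subspace K"
  proof (rule rat_complex.subspaceI)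
    show "0 \<in> K" by (rule subfield_of_complexD[OF K])
    show "x + y \<in> K" if "x \<in> K" "y \<in> K" for x y
      using that by (rule subfield_of_complexD[OF K])
    show "of_rat c * x \<in> K" if "x \<in> K" for c x
      using that Rats_subset_subfield[OF K] by (intro subfield_of_complexD[OF K]) auto
  qed
  have "y \<noteq> 1" using y(2) by auto
  have indep: "rat_complex.independent {1, y}"
  proof -
    have "y \<notin> rat_complex.span {1}"
    proof
      assume "y \<in> rat_complex.span {1}"
      then obtain q where "y = of_rat q * 1"
        by (auto simp: rat_complex.span_singleton)
      then have "y = of_real (of_rat q)" by (simp add: complex_of_rat_eq_of_real)
      then show False using y(2) by simp
    qed
    then have "rat_complex.independent (insert y {1})"
      by (intro rat_complex.independent_insertI) (auto simp: rat_complex.independent_empty)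
    then show ?thesis
      by (simp add: insert_commute)
  qed
  have "K \<subseteq> rat_complex.span {1, y}"
  proof (rule ccontr)
    assume "\<not> K \<subseteq> rat_complex.span {1, y}"
    then obtain z where z: "z \<in> K" "z \<notin> rat_complex.span {1, y}" by auto
    then have ind3: "rat_complex.independent (insert z {1, y})"
      using rat_complex.independent_insertI[OF z(2) indep] by simp
    have "z \<notin> {1, y}"
      using z(2) rat_complex.span_base by blast
    obtain Bs where Bs: "Bs \<subseteq> K" "rat_complex.independent Bs" "K \<subseteq> rat_complex.span Bs" "card Bs = 2"
      using rat_complex.basis_exists[of K] dim by metis
    have "finite Bs" using Bs(4) by (intro card_ge_0_finite) simp
    moreover have "insert z {1, y} \<subseteq> rat_complex.span Bs"
      using Bs(3) z(1) y(1) subfield_of_complexD(2)[OF K] by auto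
    ultimately have "card (insert z {1, y}) \<le> card Bs"
      using rat_complex.independent_span_bound[OF _ ind3] by blast
    then show False
      using Bs(4) \<open>z \<notin> {1, y}\<close> \<open>y \<noteq> 1\<close> by auto
  qed
  with x have "x \<in> rat_complex.span {1, y}" by auto
  then obtain p where "x - of_rat p * 1 \<in> rat_complex.span {y}"
    by (auto simp: rat_complex.span_insert)
  then obtain q where "x - of_rat p * 1 = of_rat q * y"
    by (auto simp: rat_complex.span_singleton)
  then show ?thesis
    by (intro that[of p q]) (simp add: algebra_simps)
qed

text \<open>Gauss's lemma: contents multiply, so \<open>q\<close> has content
  \<open>\<bar>a\<bar>\<close>. Cancelling \<open>a\<close> from the leading coefficients leaves
  \<open>lead_coeff g\<close> as a divisor of 1.\<close>

lemma primitive_lead_coeff_of_monic_multiple: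
  fixes f g q :: "int poly"
  assumes eq: "Polynomial.smult a f = g * q" and a: "a \<noteq> 0" and f: "lead_coeff f = 1"
    and g: "content g = 1"
  shows "\<bar>lead_coeff g\<bar> = 1"
proof -
  have "content f dvd lead_coeff f" by (rule content_dvd_coeff)
  then have cf: "content f = 1"
    using f normalize_content[of f] is_unit_normalize[of "content f"] by simp
  have "content (Polynomial.smult a f) = content (g * q)" by (simp only: eq)
  then have cq: "content q = \<bar>a\<bar>"
    using cf g by (simp add: content_mult normalize_int_def)
  have "lead_coeff (Polynomial.smult a f) = lead_coeff (g * q)" by (simp only: eq)
  then have "a = lead_coeff g * lead_coeff q"
    using f a by (simp add: lead_coeff_mult)
  moreover have "a dvd lead_coeff q"
    using content_dvd_coeff[of q "degree q"] cq by simp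
  then obtain r where "lead_coeff q = a * r" by (elim dvdE)
  ultimately have "a * (lead_coeff g * r) = a * 1" by (simp add: algebra_simps)
  then have "lead_coeff g * r = 1" using a by (metis mult_cancel_left)
  then show ?thesis
    by (metis abs_zmult_eq_1 abs_one)
qed

text \<open>The primitive integer quadratic \<open>g\<close> with root \<open>x\<close>
  pseudo-divides a monic \<open>f\<close> annihilating \<open>x\<close>: the remainder is linear and
  vanishes at a nonreal point, so it is 0. Gauss's lemma makes \<open>g\<close> monic up to sign,
  and comparing coefficients identifies \<open>p\<close> and \<open>q\<close> with integers.\<close>

lemma algebraic_int_nonreal_quadratic:
  fixes x :: complex and p q :: rat
  assumes x: "algebraic_int x" "x \<notin> \<real>" and quad: "x * x = of_rat p + of_rat q * x"
  shows "p \<in> \<int>" "q \<in> \<int>"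
proof -
  have lin: "r = 0 \<and> s = 0" if "of_real r + of_real s * x = 0" for r s :: real
  proof -
    have "s * Im x = 0" using arg_cong[OF that, of Im] by simp
    moreover have "Im x \<noteq> 0" using x(2) by (simp add: complex_is_Real_iff)
    ultimately show ?thesis using that by simp
  qed
  obtain pa pb where p: "pb > 0" "p = of_int pa / of_int pb" by (metis Rat_cases Fract_of_int_quotient)
  obtain qa qb where q: "qb > 0" "q = of_int qa / of_int qb" by (metis Rat_cases Fract_of_int_quotient)
  \<comment> \<open>The polynomial X^2 - q X - p with denominators cleared.\<close>
  define G where "G = [:- pa * qb, - qa * pb, pb * qb:]"
  define g where "g = primitive_part G"
  have "G \<noteq> 0" using p(1) q(1) by (simp add: G_def)
  have "poly (of_int_poly G) x = of_int (pb * qb) * (x * x - of_rat p - of_rat q * x)"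
    using p(1) q(1) by (simp add: G_def p(2) q(2) of_rat_divide field_simps)
  then have "poly (of_int_poly G) x = 0"
    by (simp add: quad)
  moreover have "poly (of_int_poly G) x = of_int (content G) * poly (of_int_poly g) x"
  proof -
    have "poly (of_int_poly (Polynomial.smult (content G) g)) x =
        of_int (content G) * poly (of_int_poly g) x"
      by (simp add: hom_distribs)
    then show ?thesis
      by (simp add: g_def)
  qed
  ultimately have root_g: "poly (of_int_poly g) x = 0"
    using \<open>G \<noteq> 0\<close> by simp
  have deg_g: "degree g = 2"
    using p(1) q(1) by (simp add: g_def) (simp add: G_def)
  have "g \<noteq> 0" using deg_g by auto
  obtain f where f: "poly (of_int_poly f) x = 0" "lead_coeff f = 1"
    using x(1) by (auto simp: algebraic_int_altdef_ipoly)
  define r where "r = pseudo_mod f g"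
  obtain a s where as: "a \<noteq> 0" "Polynomial.smult a f = g * s + r"
    using pseudo_mod(1)[OF \<open>g \<noteq> 0\<close>, of f] unfolding r_def by auto
  have "r = 0 \<or> degree r < 2"
    using pseudo_mod(2)[OF \<open>g \<noteq> 0\<close>, of f] deg_g unfolding r_def by auto
  then obtain r0 r1 where r: "r = [:r0, r1:]"
    by (metis degree_0 degree1_coeffs degree_0_id less_2_cases pCons_0_0 pos2 degree_pCons_0 One_nat_def)
  have "poly (of_int_poly (Polynomial.smult a f)) x = poly (of_int_poly (g * s + r)) x"
    by (simp only: as)
  then have "poly (of_int_poly r) x = 0"
    using f(1) root_g by (simp add: hom_distribs)
  then have "of_real (of_int r0) + of_real (of_int r1) * x = 0"
    by (simp add: r of_int_hom.map_poly_pCons_hom mult.commute)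
  from lin[OF this] have "r = 0" by (simp add: r)
  then have "Polynomial.smult a f = g * s" using as by simp
  then have lead: "\<bar>coeff g 2\<bar> = 1"
    using primitive_lead_coeff_of_monic_multiple[of a f g s] as(1) f(2) \<open>G \<noteq> 0\<close>
    by (simp add: g_def[symmetric] deg_g) (simp add: g_def)
  define e where "e = coeff g 2"
  have g: "g = [:coeff g 0, coeff g 1, e:]"
    using deg_g by (intro poly_eqI)
      (auto simp: coeff_pCons e_def numeral_2_eq_2 coeff_eq_0 split: nat.splits)
  have "of_int (coeff g 0) + of_int (coeff g 1) * x + of_int e * (x * x) = 0"
    using root_g by (subst (asm) g) (simp add: of_int_hom.map_poly_pCons_hom algebra_simps)
  then have "(of_int (coeff g 0) + of_int e * of_rat p) + (of_int (coeff g 1) + of_int e * of_rat q) * x = 0"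
    unfolding quad by (simp add: algebra_simps)
  then have "of_real (of_int (coeff g 0) + of_int e * of_rat p)
      + of_real (of_int (coeff g 1) + of_int e * of_rat q) * x = 0"
    by (simp add: complex_of_rat_eq_of_real)
  from lin[OF this] have "of_int e * of_rat p = (- of_int (coeff g 0) :: real)"
    "of_int e * of_rat q = (- of_int (coeff g 1) :: real)"
    by auto
  then have "(of_rat (of_int e * p) :: real) = of_rat (- of_int (coeff g 0))"
     "(of_rat (of_int e * q) :: real) = of_rat (- of_int (coeff g 1))"
    by (auto simp: of_rat_mult of_rat_minus)
  then have *: "of_int e * p = - of_int (coeff g 0)" "of_int e * q = - of_int (coeff g 1)"
    by (simp_all only: of_rat_eq_iff)
  have "e = 1 \<or> e = -1" using lead by (auto simp: e_def)
  then have "p = of_int (- e * coeff g 0)" "q = of_int (- e * coeff g 1)"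
    using * by auto
  then show "p \<in> \<int>" "q \<in> \<int>" by (metis Ints_of_int)+
qed

lemma ring_of_integers_rat: "ring_of_integers \<rat> \<subseteq> \<int>"
  using rational_algebraic_int_is_int by (auto simp: ring_of_integers_def)

lemma Reals_rat_combination:
  assumes "of_rat p + of_rat q * y \<in> (\<real> :: complex set)" and "y \<notin> \<real>"
  shows "q = 0"
proof (rule ccontr)
  assume "q \<noteq> 0"
  have "of_rat r \<in> (\<real> :: complex set)" for r
    by (simp add: complex_of_rat_eq_of_real)
  then have "(of_rat p + of_rat q * y - of_rat p) / of_rat q \<in> \<real>"
    using assms(1) by (intro Reals_divide Reals_diff)
  with \<open>q \<noteq> 0\<close> assms(2) show False by simp
qed

text \<open>A nonreal \<open>x\<close> satisfies a rational quadratic whose other root is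
  \<open>cnj x\<close>, so trace and norm are its coefficients up to sign; a real element of
  \<open>K\<close> is rational, hence an integer. With the converse below, integrality becomes two
  integer conditions that can be checked on sums by direct computation.\<close>

lemma imaginary_quadratic_trace_norm:
  assumes K: "imaginary_quadratic_field K" and x: "x \<in> ring_of_integers K"
  shows "x + cnj x \<in> \<int>" "x * cnj x \<in> \<int>"
proof -
  have sub: "subfield_of_complex K" and "\<not> K \<subseteq> \<real>"
    using K by (auto simp: imaginary_quadratic_field_def)
  then obtain y where y: "y \<in> K" "y \<notin> \<real>" by auto
  have xK: "x \<in> K" "algebraic_int x" using x by (auto simp: ring_of_integers_def)
  show "x + cnj x \<in> \<int>" "x * cnj x \<in> \<int>"
  proof (atomize(full), cases "x \<in> \<real>")
    case True
    obtain p q where pq: "x = of_rat p + of_rat q * y"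
      using imaginary_quadratic_obtain_coordinates[OF K xK(1) y] .
    with True have "q = 0" using y(2) Reals_rat_combination by metis
    then have "x \<in> \<rat>" using pq by simp
    then have "x \<in> \<int>" using rational_algebraic_int_is_int xK(2) by blast
    then show "x + cnj x \<in> \<int> \<and> x * cnj x \<in> \<int>"
      by (auto elim!: Ints_cases simp flip: of_int_add of_int_mult)
  next
    case False
    obtain p q where pq: "x * x = of_rat p + of_rat q * x"
      using imaginary_quadratic_obtain_coordinates[OF K _ xK(1) False] subfield_of_complexD(4)[OF sub xK(1) xK(1)] by metis
    have "cnj x * cnj x = of_rat p + of_rat q * cnj x"
      using arg_cong[OF pq, of cnj] by (simp add: complex_of_rat_eq_of_real)
    with pq have "(x - cnj x) * (x + cnj x) = (x - cnj x) * of_rat q"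
      by (simp add: algebra_simps)
    moreover have "x - cnj x \<noteq> 0"
      using False Reals_cnj_iff[of x] by auto
    ultimately have trace: "x + cnj x = of_rat q"
      by (metis mult_cancel_left)
    have "x * cnj x = x * (x + cnj x) - x * x" by (simp add: algebra_simps)
    also have "\<dots> = of_rat (- p)" by (simp add: trace pq algebra_simps of_rat_minus)
    finally have norm: "x * cnj x = of_rat (- p)" .
    have "p \<in> \<int>" "q \<in> \<int>"
      using algebraic_int_nonreal_quadratic[OF xK(2) False pq] by auto
    then show "x + cnj x \<in> \<int> \<and> x * cnj x \<in> \<int>"
      unfolding trace norm by (auto elim!: Ints_cases simp: of_rat_minus)
  qed
qed

lemma algebraic_int_of_trace_norm:
  assumes "x + cnj x \<in> \<int>" "x * cnj x \<in> \<int>"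
  shows "algebraic_int x"
proof -
  define p where "p = [:x * cnj x, - (x + cnj x), 1:]"
  have "poly p x = 0" "lead_coeff p = 1"
    by (auto simp: p_def algebra_simps)
  moreover have "coeff p i \<in> \<int>" for i
    using assms by (auto simp: p_def coeff_pCons simp del: minus_add_distrib split: nat.splits)
  ultimately show ?thesis by (intro algebraic_int.intros[of p]) auto
qed

lemma quadratic_root_int:
  fixes r :: rat and t n :: int
  assumes "r * r = of_int t * r - of_int n"
  shows "r \<in> \<int>"
proof -
  define p where "p = [:of_int n, - of_int t, 1 :: rat:]"
  have "poly p r = 0" "lead_coeff p = 1"
    using assms by (auto simp: p_def algebra_simps)
  moreover have "coeff p i \<in> \<int>" for i
    by (auto simp: p_def coeff_pCons split: nat.splits)
  ultimately have "algebraic_int r" by (intro algebraic_int.intros[of p]) auto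
  then show ?thesis using rational_algebraic_int_is_int[of r] by (simp add: Rats_def of_rat_def)
qed

text \<open>
  With \<open>t = x + cnj x\<close>, \<open>n = x * cnj x\<close> and likewise \<open>t'\<close>, \<open>n'\<close> for \<open>y\<close>, the numbers
  \<open>x * cnj y + cnj x * y\<close> and \<open>x * y + cnj x * cnj y\<close> have sum \<open>t * t'\<close> and product
  \<open>n' * (t\<^sup>2 - 2 * n) + n * (t'\<^sup>2 - 2 * n')\<close>, so the first one is a rational algebraic integer.
\<close>
lemma imaginary_quadratic_integers_add:
  assumes K: "imaginary_quadratic_field K"
    and x: "x \<in> ring_of_integers K" and y: "y \<in> ring_of_integers K"
  shows "x + y \<in> ring_of_integers K"
proof -
  have sub: "subfield_of_complex K"
    using K by (auto simp: imaginary_quadratic_field_def)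
  obtain t where t: "x + cnj x = of_int t" using imaginary_quadratic_trace_norm[OF K x] by (auto elim: Ints_cases)
  obtain n where n: "x * cnj x = of_int n" using imaginary_quadratic_trace_norm[OF K x] by (auto elim: Ints_cases)
  obtain t' where t': "y + cnj y = of_int t'" using imaginary_quadratic_trace_norm[OF K y] by (auto elim: Ints_cases)
  obtain n' where n': "y * cnj y = of_int n'" using imaginary_quadratic_trace_norm[OF K y] by (auto elim: Ints_cases)
  define r where "r = x * cnj y + cnj x * y"
  have r: "r = of_int t * of_int t' - (x * y + cnj x * cnj y)"
    unfolding r_def t[symmetric] t'[symmetric] by (simp add: algebra_simps)
  have "r * r = of_int (t * t') * r - of_int (n' * (t * t - 2 * n) + n * (t' * t' - 2 * n'))"
    unfolding of_int_mult of_int_add of_int_diff of_int_numeral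
      t[symmetric] t'[symmetric] n[symmetric] n'[symmetric] r_def
    by (simp add: algebra_simps)
  \<comment> \<open>Substituting \<open>cnj x = t - x\<close> and \<open>cnj y = t' - y\<close> puts
    \<open>r\<close> into \<open>K\<close>; being real, it is rational.\<close>
  moreover have "r \<in> \<rat>"
  proof -
    obtain z where z: "z \<in> K" "z \<notin> \<real>" using K by (auto simp: imaginary_quadratic_field_def)
    have "x \<in> K" "y \<in> K" using x y by (auto simp: ring_of_integers_def)
    moreover have "of_int t \<in> K" "of_int t' \<in> K"
      using Rats_subset_subfield[OF sub] by auto
    ultimately have "x * (of_int t' - y) + (of_int t - x) * y \<in> K"
      by (intro subfield_of_complexD[OF sub])
    moreover have "x * (of_int t' - y) + (of_int t - x) * y = r"
      unfolding r_def t[symmetric] t'[symmetric] by (simp add: algebra_simps)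
    ultimately have "r \<in> K" by simp
    then obtain p q where pq: "r = of_rat p + of_rat q * z"
      using imaginary_quadratic_obtain_coordinates[OF K _ z] by metis
    have "r \<in> \<real>" by (simp add: r_def complex_is_Real_iff)
    then have "q = 0" using z(2) pq Reals_rat_combination by metis
    then show ?thesis using pq by simp
  qed
  then obtain r' where r': "r = of_rat r'" by (auto simp: Rats_def)
  ultimately have "of_rat (r' * r') =
      (of_rat (of_int (t * t') * r' - of_int (n' * (t * t - 2 * n) + n * (t' * t' - 2 * n'))) :: complex)"
    by (simp only: of_rat_mult of_rat_diff of_rat_of_int_eq)
  then have "r' \<in> \<int>"
    unfolding of_rat_eq_iff by (rule quadratic_root_int)
  then have "r \<in> \<int>" unfolding r' by (auto elim!: Ints_cases)
  have "(x + y) + cnj (x + y) = of_int (t + t')"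
    by (simp add: t[symmetric] t'[symmetric])
  moreover have "(x + y) * cnj (x + y) = of_int (n + n') + r"
    by (simp add: n[symmetric] n'[symmetric] r_def algebra_simps)
  ultimately have "algebraic_int (x + y)"
    using \<open>r \<in> \<int>\<close> by (intro algebraic_int_of_trace_norm) auto
  then show ?thesis
    using x y subfield_of_complexD(5)[OF sub] by (simp add: ring_of_integers_def)
qed

lemma ring_of_integers_int_mult:
  assumes K: "imaginary_quadratic_field K" and x: "x \<in> ring_of_integers K"
  shows "of_int b * x \<in> ring_of_integers K"
proof -
  have sub: "subfield_of_complex K"
    using K by (auto simp: imaginary_quadratic_field_def)
  have "of_int b * x + cnj (of_int b * x) = of_int b * (x + cnj x)"
    "of_int b * x * cnj (of_int b * x) = of_int (b * b) * (x * cnj x)"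
    by (simp_all add: algebra_simps)
  then have "algebraic_int (of_int b * x)"
    using imaginary_quadratic_trace_norm[OF K x] by (intro algebraic_int_of_trace_norm) (metis Ints_mult Ints_of_int)+
  moreover have "of_int b * x \<in> K"
    using x Rats_subset_subfield[OF sub] by (intro subfield_of_complexD[OF sub]) (auto simp: ring_of_integers_def)
  ultimately show ?thesis by (simp add: ring_of_integers_def)
qed

text \<open>In the quadratic case the squared absolute value is the norm \<open>s * cnj s\<close>, a
  positive integer. The arithmetic of \<open>K\<close> enters the estimate only here.\<close>

lemma norm_int_combination_ge_1:
  fixes \<beta> :: "nat \<Rightarrow> complex" and b :: "nat \<Rightarrow> int"
  assumes K: "K = \<rat> \<or> imaginary_quadratic_field K"
    and \<beta>: "\<forall>i\<le>m. \<beta> i \<in> ring_of_integers K"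
    and nz: "(\<Sum>i\<le>m. \<beta> i * of_int (b i)) \<noteq> 0"
  shows "cmod (\<Sum>i\<le>m. \<beta> i * of_int (b i)) \<ge> 1"
  using K
proof
  assume "K = \<rat>"
  then have "(\<Sum>i\<le>m. \<beta> i * of_int (b i)) \<in> \<int>"
    using \<beta> ring_of_integers_rat by (intro Ints_sum Ints_mult) auto
  then obtain z where "(\<Sum>i\<le>m. \<beta> i * of_int (b i)) = of_int z"
    by (elim Ints_cases)
  then show ?thesis using nz by auto
next
  assume K: "imaginary_quadratic_field K"
  have "(\<Sum>i\<le>k. \<beta> i * of_int (b i)) \<in> ring_of_integers K" if "k \<le> m" for k
    using that
  proof (induction k)
    case 0
    then show ?case
      using ring_of_integers_int_mult[OF K, of "\<beta> 0" "b 0"] \<beta> by (simp add: mult.commute)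
  next
    case (Suc k)
    then show ?case
      using ring_of_integers_int_mult[OF K, of "\<beta> (Suc k)" "b (Suc k)"] \<beta>
      by (auto intro!: imaginary_quadratic_integers_add[OF K] simp: mult.commute)
  qed
  then obtain z where z: "(\<Sum>i\<le>m. \<beta> i * of_int (b i)) * cnj (\<Sum>i\<le>m. \<beta> i * of_int (b i)) = of_int z"
    using imaginary_quadratic_trace_norm(2)[OF K] by (metis Ints_cases order.refl)
  define s where "s = (\<Sum>i\<le>m. \<beta> i * of_int (b i))"
  have "complex_of_real ((cmod s)\<^sup>2) = complex_of_real (of_int z)"
    using z unfolding s_def[symmetric] complex_norm_square by simp
  then have "(cmod s)\<^sup>2 = of_int z"
    by (simp only: of_real_eq_iff)
  moreover from this have "0 < real_of_int z"
    using nz unfolding s_def[symmetric] by (metis zero_less_power zero_less_norm_iff)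
  ultimately have "1\<^sup>2 \<le> (cmod s)\<^sup>2" by simp
  then show ?thesis
    unfolding s_def[symmetric] by (rule power2_le_imp_le) simp
qed

section \<open>Siegel's lemma\<close>

text \<open>Pigeonhole on the box of vectors with entries in \<open>{..B}\<close>. Nonnegative
  coefficients send it into \<open>{..R * B}\<close> in each coordinate, and the difference of two
  colliding vectors is the solution, with entries still bounded by \<open>B\<close>.\<close>

lemma siegel_nonneg:
  fixes a :: "'i \<Rightarrow> 'k \<Rightarrow> nat" and R B :: nat
  assumes I: "finite I" and J: "finite J" and R: "R \<ge> 1"
    and rows: "\<And>i. i \<in> I \<Longrightarrow> (\<Sum>k\<in>J. a i k) \<le> R"
    and IJ: "card I \<le> card J"
    and B: "R ^ card I < (B + 1) ^ (card J - card I)"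
  obtains x :: "'k \<Rightarrow> int" where "\<exists>k\<in>J. x k \<noteq> 0" "\<And>k. k \<in> J \<Longrightarrow> \<bar>x k\<bar> \<le> int B"
    "\<And>i. i \<in> I \<Longrightarrow> (\<Sum>k\<in>J. int (a i k) * x k) = 0"
proof -
  define D where "D = (J \<rightarrow>\<^sub>E {..B})"
  define F where "F = (\<lambda>y. \<lambda>i\<in>I. \<Sum>k\<in>J. a i k * y k)"
  have "F ` D \<subseteq> (I \<rightarrow>\<^sub>E {..R * B})"
  proof (rule image_subsetI)
    fix y assume y: "y \<in> D"
    have "(\<Sum>k\<in>J. a i k * y k) \<le> R * B" if i: "i \<in> I" for i
    proof -
      have "(\<Sum>k\<in>J. a i k * y k) \<le> (\<Sum>k\<in>J. a i k * B)"
        using y by (intro sum_mono mult_left_mono) (auto simp: D_def PiE_def Pi_def)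
      also have "\<dots> \<le> R * B"
        using rows[OF i] by (simp flip: sum_distrib_right)
      finally show ?thesis .
    qed
    then show "F y \<in> (I \<rightarrow>\<^sub>E {..R * B})"
      by (auto simp: F_def)
  qed
  moreover have fin: "finite (I \<rightarrow>\<^sub>E {..R * B})"
    using I by (intro finite_PiE) auto
  ultimately have "card (F ` D) \<le> card (I \<rightarrow>\<^sub>E {..R * B})"
    by (intro card_mono)
  also have "\<dots> = (R * B + 1) ^ card I"
    using I by (simp add: card_PiE)
  \<comment> \<open>Weakening \<open>R * B + 1\<close> to \<open>R * (B + 1)\<close> separates the
    powers of \<open>R\<close> from those of \<open>B + 1\<close>.\<close>
  also have "\<dots> \<le> (R * (B + 1)) ^ card I"
    using R by (intro power_mono) auto
  also have "\<dots> = R ^ card I * (B + 1) ^ card I"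
    by (rule power_mult_distrib)
  also have "\<dots> < (B + 1) ^ (card J - card I) * (B + 1) ^ card I"
    using B by (intro mult_strict_right_mono) auto
  also have "\<dots> = card D"
    using J IJ by (simp add: D_def card_PiE flip: power_add)
  finally have "\<not> inj_on F D"
    by (rule pigeonhole)
  then obtain y z where yz: "y \<in> D" "z \<in> D" "F y = F z" "y \<noteq> z"
    by (auto simp: inj_on_def)
  define x where "x = (\<lambda>k. int (y k) - int (z k))"
  show ?thesis
  proof (rule that[of x])
    obtain k where "y k \<noteq> z k" using yz(4) by auto
    moreover from this have "k \<in> J"
      using yz(1,2) PiE_arb[of y J _ k] PiE_arb[of z J _ k] unfolding D_def by metis
    ultimately show "\<exists>k\<in>J. x k \<noteq> 0"
      by (auto simp: x_def)
    show "\<bar>x k\<bar> \<le> int B" if "k \<in> J" for k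
    proof -
      have "y k \<le> B" "z k \<le> B"
        using that yz(1,2) by (auto simp: D_def PiE_def Pi_def)
      then show ?thesis by (simp add: x_def)
    qed
    show "(\<Sum>k\<in>J. int (a i k) * x k) = 0" if "i \<in> I" for i
    proof -
      have "(\<Sum>k\<in>J. a i k * y k) = (\<Sum>k\<in>J. a i k * z k)"
        using fun_cong[OF yz(3), of i] that by (simp add: F_def)
      then have "(\<Sum>k\<in>J. int (a i k) * int (y k)) = (\<Sum>k\<in>J. int (a i k) * int (z k))"
        by (metis (mono_tags, lifting) of_nat_mult of_nat_sum sum.cong)
      then show ?thesis
        by (simp add: x_def right_diff_distrib sum_subtractf)
    qed
  qed
qed

section \<open>Zero estimate\<close>

lemma det_dvd_of_rows:
  fixes f :: "nat \<Rightarrow> nat \<Rightarrow> 'a :: comm_ring_1"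
  assumes "\<And>i j. i < n \<Longrightarrow> j < n \<Longrightarrow> d i dvd f i j"
  shows "(\<Prod>i<n. d i) dvd det (mat n n (\<lambda>(i, j). f i j))"
proof -
  have "(\<Prod>i<n. d i) dvd (\<Prod>i = 0..<n. mat n n (\<lambda>(i, j). f i j) $$ (i, p i))"
    if "p permutes {0..<n}" for p
  proof -
    have "p i < n" if "i < n" for i
      using permutes_in_image[OF \<open>p permutes _\<close>, of i] that by simp
    then show ?thesis
      unfolding lessThan_atLeast0 by (intro prod_dvd_prod) (simp add: assms)
  qed
  then show ?thesis
    by (subst det_def'[of _ n]) (auto intro!: dvd_sum dvd_mult)
qed

text \<open>Multiplying by the triangular matrix \<open>c\<close> changes the determinant only by
  its diagonal product. Thus high vanishing order of a combination of rows passes to the determinant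
  of the original rows.\<close>

lemma dvd_det_of_row_combination:
  fixes f :: "nat \<Rightarrow> nat \<Rightarrow> 'a :: comm_ring_1" and c :: "nat \<Rightarrow> nat \<Rightarrow> 'a"
  assumes lower: "\<And>i j. i < j \<Longrightarrow> j < n \<Longrightarrow> c i j = 0"
    and dvd: "\<And>i j. i < n \<Longrightarrow> j < n \<Longrightarrow> d i dvd (\<Sum>k<n. c i k * f k j)"
  shows "(\<Prod>i<n. d i) dvd (\<Prod>i<n. c i i) * det (mat n n (\<lambda>(i, j). f i j))"
proof -
  let ?C = "mat n n (\<lambda>(i, j). c i j)" and ?F = "mat n n (\<lambda>(i, j). f i j)"
  have "?C * ?F = mat n n (\<lambda>(i, j). \<Sum>k<n. c i k * f k j)"
    by (rule eq_matI) (auto simp: scalar_prod_def lessThan_atLeast0 intro!: sum.cong)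
  then have "(\<Prod>i<n. d i) dvd det (?C * ?F)"
    using det_dvd_of_rows[of n d "\<lambda>i j. \<Sum>k<n. c i k * f k j"] dvd by simp
  also have "det (?C * ?F) = det ?C * det ?F"
    by (rule det_mult) auto
  also have "det ?C = (\<Prod>i<n. c i i)"
  proof -
    have "det ?C = prod_list (diag_mat ?C)"
      by (rule det_lower_triangular[of n]) (auto simp: lower)
    also have "\<dots> = (\<Prod>i\<leftarrow>[0..<n]. c i i)"
      unfolding diag_mat_def by (intro arg_cong[of _ _ prod_list] map_cong) auto
    also have "\<dots> = (\<Prod>i\<in>set [0..<n]. c i i)"
      by (rule prod.distinct_set_conv_list[symmetric]) simp
    finally show ?thesis
      by (simp add: lessThan_atLeast0)
  qed
  finally show ?thesis .
qed

lemma det_scale_rows: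
  fixes f :: "nat \<Rightarrow> nat \<Rightarrow> 'a :: comm_ring_1"
  shows "det (mat n n (\<lambda>(i, j). u i * f i j)) = (\<Prod>i<n. u i) * det (mat n n (\<lambda>(i, j). f i j))"
proof -
  have "(\<Prod>i = 0..<n. mat n n (\<lambda>(i, j). u i * f i j) $$ (i, p i)) =
        (\<Prod>i<n. u i) * (\<Prod>i = 0..<n. mat n n (\<lambda>(i, j). f i j) $$ (i, p i))"
    if "p permutes {0..<n}" for p
  proof -
    have "p i < n" if "i < n" for i
      using permutes_in_image[OF \<open>p permutes _\<close>, of i] that by simp
    then show ?thesis
      by (simp add: lessThan_atLeast0 prod.distrib[symmetric])
  qed
  then show ?thesis
    by (subst (1 2) det_def'[of _ n]) (auto simp: sum_distrib_left mult.left_commute intro!: sum.cong)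
qed

lemma coeff_mult_sum_bounds:
  fixes p q :: "'a :: comm_ring_1 poly"
  assumes "degree p \<le> a" "degree q \<le> b"
  shows "coeff (p * q) (a + b) = coeff p a * coeff q b"
proof -
  have "coeff p i * coeff q (a + b - i) = 0" if "i \<noteq> a" for i
    using that assms by (cases "i < a") (auto simp: coeff_eq_0)
  then show ?thesis
    unfolding coeff_mult by (subst sum.remove[of _ a]) auto
qed

lemma coeff_prod_sum_bounds:
  fixes p :: "'i \<Rightarrow> 'a :: comm_ring_1 poly"
  assumes "finite I" and "\<And>i. i \<in> I \<Longrightarrow> degree (p i) \<le> d i"
  shows "coeff (\<Prod>i\<in>I. p i) (\<Sum>i\<in>I. d i) = (\<Prod>i\<in>I. coeff (p i) (d i)) \<and>
         degree (\<Prod>i\<in>I. p i) \<le> (\<Sum>i\<in>I. d i)"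
  using assms
proof (induction I rule: finite_induct)
  case (insert i I)
  have "degree (p i * (\<Prod>i\<in>I. p i)) \<le> d i + (\<Sum>i\<in>I. d i)"
    using insert by (intro order.trans[OF degree_mult_le]) (auto intro!: add_mono)
  then show ?case
    using insert by (auto simp: coeff_mult_sum_bounds)
qed auto

text \<open>
  \<open>twisted_pderiv a\<close> is \<open>d/dx - a\<close>, that is, differentiation conjugated by \<open>exp (- a x)\<close>; hence
  \<open>twisted_wronskian n A\<close> is, up to an exponential factor, the Wronskian of the functions
  \<open>A j * exp (- j x)\<close>.
\<close>
definition twisted_pderiv :: "complex \<Rightarrow> complex poly \<Rightarrow> complex poly" where
  "twisted_pderiv a p = pderiv p - Polynomial.smult a p"

lemma degree_twisted_pderiv_le:
  assumes "degree p \<le> n"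
  shows "degree (twisted_pderiv a p) \<le> n"
  unfolding twisted_pderiv_def using assms
  by (intro degree_diff_le) (auto simp: degree_pderiv)

lemma degree_funpow_twisted_pderiv_le:
  assumes "degree p \<le> n"
  shows "degree ((twisted_pderiv a ^^ t) p) \<le> n"
  by (induction t) (auto simp: assms intro: degree_twisted_pderiv_le)

text \<open>Stated at the fixed index \<open>degree p\<close>, because for \<open>a = 0\<close> the
  degree really drops and the coefficient there is 0 once \<open>t > 0\<close>.\<close>

lemma coeff_funpow_twisted_pderiv_degree:
  fixes a :: complex and t :: nat
  shows "coeff ((twisted_pderiv a ^^ t) p) (degree p) = (-a) ^ t * lead_coeff p"
proof (induction t)
  case (Suc t)
  have "coeff ((twisted_pderiv a ^^ t) p) (Suc (degree p)) = 0"
    using degree_funpow_twisted_pderiv_le[of p "degree p" t a] by (intro coeff_eq_0) simp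
  then show ?case
    using Suc by (simp add: twisted_pderiv_def[of a "(twisted_pderiv a ^^ t) p"] coeff_pderiv)
qed simp

lemma fps_deriv_funpow_times_exp:
  "(fps_deriv ^^ t) (fps_of_poly p * fps_exp (-a)) =
     fps_of_poly ((twisted_pderiv a ^^ t) p) * fps_exp (-a)"
proof (induction t)
  case (Suc t)
  have neg: "fps_const (-a) = - fps_const a" by simp
  show ?case
    unfolding funpow.simps o_apply Suc twisted_pderiv_def fps_deriv_mult fps_exp_deriv
      fps_of_poly_diff fps_of_poly_pderiv fps_of_poly_smult neg
    by (simp add: algebra_simps del: fps_const_neg)
qed simp

lemma twisted_pderiv_shift:
  "(twisted_pderiv a ^^ t) (p \<circ>\<^sub>p [:c, 1:]) = (twisted_pderiv a ^^ t) p \<circ>\<^sub>p [:c, 1:]"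
  by (induction t)
     (simp_all add: twisted_pderiv_def pderiv_pcompose pcompose_diff pcompose_smult pderiv_pCons)

section \<open>Orders of vanishing and the twisted Wronskian\<close>

lemma fps_X_power_dvd_iff_nth:
  fixes f :: "'a :: field fps"
  shows "fps_X ^ n dvd f \<longleftrightarrow> (\<forall>i<n. fps_nth f i = 0)"
proof (cases "f = 0")
  case False
  then have "fps_X ^ n dvd f \<longleftrightarrow> n \<le> subdegree f"
    by (simp add: fps_dvd_iff)
  also have "\<dots> \<longleftrightarrow> (\<forall>i<n. fps_nth f i = 0)"
    using False subdegree_geI[of f n] by (meson less_le_trans nth_less_subdegree_zero)
  finally show ?thesis .
qed simp

lemma fps_X_power_dvd_funpow_deriv:
  fixes f :: "'a :: field fps"
  assumes "fps_X ^ n dvd f"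
  shows "fps_X ^ (n - t) dvd (fps_deriv ^^ t) f"
proof (induction t)
  case (Suc t)
  then show ?case
    unfolding fps_X_power_dvd_iff_nth by simp
qed (simp add: assms)

definition twisted_wronskian :: "nat \<Rightarrow> (nat \<Rightarrow> complex poly) \<Rightarrow> complex poly" where
  "twisted_wronskian n A =
     det (mat n n (\<lambda>(j, k). (twisted_pderiv (of_nat j) ^^ k) (A j)))"

text \<open>A kernel vector would be the coefficient vector of a nonzero polynomial of degree below
  \<open>n\<close> with the \<open>n\<close> distinct roots 0, -1, ..., -(n-1).\<close>

lemma det_vandermonde_neg_nonzero:
  assumes "\<And>j. j < n \<Longrightarrow> l j \<noteq> (0 :: complex)"
  shows "det (mat n n (\<lambda>(j, k). (- of_nat j) ^ k * l j)) \<noteq> 0"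
proof
  let ?V = "mat n n (\<lambda>(j, k). (- of_nat j) ^ k * l j)"
  assume "det ?V = 0"
  then obtain v where v: "v \<in> carrier_vec n" "v \<noteq> 0\<^sub>v n" "?V *\<^sub>v v = 0\<^sub>v n"
    using det_0_iff_vec_prod_zero[of ?V n] by auto
  define p where "p = (\<Sum>k<n. monom (vec_index v k) k)"
  have coeff_p: "coeff p k = (if k < n then vec_index v k else 0)" for k
    unfolding p_def by (simp add: coeff_sum)
  have "poly p (- of_nat j) = 0" if "j < n" for j
  proof -
    have "vec_index (?V *\<^sub>v v) j = l j * poly p (- of_nat j)"
      using that v(1) 
      by (auto simp: scalar_prod_def p_def poly_sum poly_monom lessThan_atLeast0 sum_distrib_left mult_ac
               intro!: sum.cong)
    then show ?thesis
      using v(3) that assms[OF that] by simp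
  qed
  then have sub: "(\<lambda>j. - of_nat j) ` {..<n} \<subseteq> {x. poly p x = 0}"
    by auto
  obtain k where k: "k < n" "vec_index v k \<noteq> 0"
    using v(1,2) by (metis carrier_vecD eq_vecI index_zero_vec)
  then have "p \<noteq> 0"
    using coeff_p[of k] by auto
  moreover have "degree p < n"
    using k(1) coeff_p by (metis coeff_eq_0 degree_0 leading_coeff_0_iff gr_zeroI less_nat_zero_code linorder_not_less)
  moreover have "card ((\<lambda>j. - of_nat j :: complex) ` {..<n}) = n"
    by (subst card_image) (auto simp: inj_on_def)
  ultimately show False
    using card_mono[OF poly_roots_finite sub] card_poly_roots_bound[of p] by simp
qed

text \<open>No twisted derivative raises the degree, and the coefficient at the sum of the degrees
  is a Vandermonde determinant with nodes \<open>- j\<close>, scaled by the leading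
  coefficients.\<close>

lemma twisted_wronskian_nonzero:
  assumes "\<And>j. j < n \<Longrightarrow> A j \<noteq> 0"
  shows "twisted_wronskian n A \<noteq> 0"
    and "degree (twisted_wronskian n A) \<le> (\<Sum>j<n. degree (A j))"
proof -
  let ?f = "\<lambda>j k. (twisted_pderiv (of_nat j) ^^ k) (A j)"
  let ?d = "\<Sum>j = 0..<n. degree (A j)"
  have W: "twisted_wronskian n A =
      (\<Sum>p | p permutes {0..<n}. signof p * (\<Prod>j = 0..<n. ?f j (p j)))"
  proof -
    have "mat n n (\<lambda>(j, k). ?f j k) $$ (j, p j) = ?f j (p j)" if "p permutes {0..<n}" "j < n" for j p
      using permutes_in_image[OF that(1), of j] that(2) by simp
    then show ?thesis
      unfolding twisted_wronskian_def by (subst det_def'[of _ n]) (auto intro!: sum.cong)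
  qed
  have signof_poly: "(signof p :: complex poly) = [:signof p:]" for p :: "nat \<Rightarrow> nat"
    by (auto simp: sign_def one_pCons)
  note bounds = coeff_prod_sum_bounds[of "{0..<n}" _ "\<lambda>j. degree (A j)"]
  have "coeff (twisted_wronskian n A) ?d =
      (\<Sum>p | p permutes {0..<n}. signof p * (\<Prod>j = 0..<n. (- of_nat j) ^ p j * lead_coeff (A j)))"
    unfolding W coeff_sum signof_poly
    by (intro sum.cong refl)
       (simp add: bounds degree_funpow_twisted_pderiv_le coeff_funpow_twisted_pderiv_degree)
  also have "\<dots> = det (mat n n (\<lambda>(j, k). (- of_nat j) ^ k * lead_coeff (A j)))"
  proof -
    have "mat n n (\<lambda>(j, k). (- of_nat j) ^ k * lead_coeff (A j)) $$ (j, p j)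
        = (- of_nat j) ^ p j * lead_coeff (A j)" if "p permutes {0..<n}" "j < n" for j p
      using permutes_in_image[OF that(1), of j] that(2) by simp
    then show ?thesis
      by (subst det_def'[of _ n]) (auto intro!: sum.cong)
  qed
  also have "\<dots> \<noteq> 0"
    by (rule det_vandermonde_neg_nonzero) (simp add: assms)
  finally show "twisted_wronskian n A \<noteq> 0"
    by auto
  have "degree (signof p * (\<Prod>j = 0..<n. ?f j (p j))) \<le> ?d" for p
    unfolding signof_poly by (simp add: bounds degree_funpow_twisted_pderiv_le)
  then show "degree (twisted_wronskian n A) \<le> (\<Sum>j<n. degree (A j))"
    unfolding W lessThan_atLeast0 by (intro degree_sum_le) (simp_all add: finite_permutations)
qed

interpretation fps_of_poly_hom: comm_ring_hom fps_of_poly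
  by unfold_locales (simp_all add: fps_of_poly_add fps_of_poly_mult)

lemma twisted_wronskian_shift:
  "twisted_wronskian n A \<circ>\<^sub>p [:c, 1:] = twisted_wronskian n (\<lambda>j. A j \<circ>\<^sub>p [:c, 1:])"
proof -
  have "map_mat (\<lambda>p. p \<circ>\<^sub>p [:c, 1:]) (mat n n (\<lambda>(j, k). (twisted_pderiv (of_nat j) ^^ k) (A j))) =
        mat n n (\<lambda>(j, k). (twisted_pderiv (of_nat j) ^^ k) (A j \<circ>\<^sub>p [:c, 1:]))"
    by (rule eq_matI) (auto simp: twisted_pderiv_shift)
  moreover have "det (map_mat (\<lambda>p. p \<circ>\<^sub>p [:c, 1:]) (mat n n (\<lambda>(j, k). (twisted_pderiv (of_nat j) ^^ k) (A j))))
      = det (mat n n (\<lambda>(j, k). (twisted_pderiv (of_nat j) ^^ k) (A j))) \<circ>\<^sub>p [:c, 1:]"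
    by (rule comm_ring_hom.hom_det[OF pcompose_hom.comm_ring_hom_axioms])
  ultimately show ?thesis
    unfolding twisted_wronskian_def by (simp only:)
qed

text \<open>Entries of the Wronskian are derivatives of order at most \<open>m\<close>, so each
  combined row keeps order at least \<open>e i - m\<close>. The diagonal of \<open>c\<close> and the
  exponentials are units among power series and cancel.\<close>

lemma fps_X_power_dvd_twisted_wronskian:
  fixes A :: "nat \<Rightarrow> complex poly" and c :: "nat \<Rightarrow> nat \<Rightarrow> complex"
  assumes lower: "\<And>i j. i < j \<Longrightarrow> j \<le> m \<Longrightarrow> c i j = 0"
    and diag: "\<And>i. i \<le> m \<Longrightarrow> c i i \<noteq> 0"
    and dvd: "\<And>i. i \<le> m \<Longrightarrow>
      fps_X ^ e i dvd (\<Sum>k\<le>m. fps_const (c i k) * (fps_of_poly (A k) * fps_exp (- of_nat k)))"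
  shows "fps_X ^ (\<Sum>i\<le>m. e i - m) dvd fps_of_poly (twisted_wronskian (Suc m) A)"
proof -
  define n where "n = Suc m"
  define g where "g = (\<lambda>k. fps_of_poly (A k) * fps_exp (- of_nat k :: complex))"
  let ?P = "\<lambda>j k. (twisted_pderiv (of_nat j) ^^ k) (A j)"
  have deriv_comb: "(fps_deriv ^^ j) (\<Sum>k<n. fps_const (c i k) * g k) =
      (\<Sum>k<n. fps_const (c i k) * (fps_deriv ^^ j) (g k))" for i j
    by (induction j) (simp_all add: fps_deriv_sum)
  have "fps_X ^ (e i - m) dvd (\<Sum>k<n. fps_const (c i k) * (fps_deriv ^^ j) (g k))"
    if "i < n" "j < n" for i j
  proof -
    have "fps_X ^ (e i - j) dvd (fps_deriv ^^ j) (\<Sum>k<n. fps_const (c i k) * g k)"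
      by (rule fps_X_power_dvd_funpow_deriv)
         (use dvd[of i] that in \<open>simp add: g_def n_def lessThan_Suc_atMost\<close>)
    moreover have "fps_X ^ (e i - m) dvd (fps_X ^ (e i - j) :: complex fps)"
      using that by (intro le_imp_power_dvd) (simp add: n_def)
    ultimately show ?thesis
      unfolding deriv_comb by (rule dvd_trans[rotated])
  qed
  then have "(\<Prod>i<n. fps_X ^ (e i - m)) dvd
      (\<Prod>i<n. fps_const (c i i)) * det (mat n n (\<lambda>(i, j). (fps_deriv ^^ j) (g i)))"
    by (intro dvd_det_of_row_combination) (auto simp: lower n_def)
  also have "det (mat n n (\<lambda>(i, j). (fps_deriv ^^ j) (g i))) =
      det (mat n n (\<lambda>(i, j). fps_exp (- of_nat i) * fps_of_poly (?P i j)))"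
    unfolding g_def fps_deriv_funpow_times_exp by (simp add: mult.commute)
  also have "\<dots> = (\<Prod>i<n. fps_exp (- of_nat i)) * det (mat n n (\<lambda>(i, j). fps_of_poly (?P i j)))"
    by (rule det_scale_rows)
  also have "mat n n (\<lambda>(i, j). fps_of_poly (?P i j)) = map_mat fps_of_poly (mat n n (\<lambda>(i, j). ?P i j))"
    by (rule eq_matI) auto
  also have "det \<dots> = fps_of_poly (twisted_wronskian n A)"
    unfolding twisted_wronskian_def by (rule fps_of_poly_hom.hom_det)
  also have "(\<Prod>i<n. fps_X ^ (e i - m)) = (fps_X ^ (\<Sum>i\<le>m. e i - m) :: complex fps)"
    by (simp add: power_sum n_def lessThan_Suc_atMost)
  finally have *: "fps_X ^ (\<Sum>i\<le>m. e i - m) dvd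
     ((\<Prod>i<n. fps_const (c i i)) * (\<Prod>i<n. fps_exp (- of_nat i))) * fps_of_poly (twisted_wronskian n A)"
    by (simp only: mult.assoc)
  have nth0: "fps_nth (\<Prod>i\<in>I. f i) 0 = (\<Prod>i\<in>I. fps_nth (f i) 0)"
    for f :: "nat \<Rightarrow> complex fps" and I
    by (induction I rule: infinite_finite_induct) auto
  have "is_unit ((\<Prod>i<n. fps_const (c i i)) * (\<Prod>i<n. fps_exp (- of_nat i)))"
    using diag by (simp add: nth0 n_def)
  with * show ?thesis
    by (simp add: dvd_mult_unit_iff' n_def)
qed

lemma dvd_poly_iff_fps_X_power_dvd:
  fixes p :: "complex poly"
  shows "[:-c, 1:] ^ n dvd p \<longleftrightarrow> fps_X ^ n dvd fps_of_poly (p \<circ>\<^sub>p [:c, 1:])"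
proof
  assume "[:-c, 1:] ^ n dvd p"
  then obtain q where "p = [:-c, 1:] ^ n * q" by (elim dvdE)
  then have "p \<circ>\<^sub>p [:c, 1:] = [:0, 1:] ^ n * (q \<circ>\<^sub>p [:c, 1:])"
    by (simp add: pcompose_mult pcompose_hom.hom_power pcompose_pCons)
  then show "fps_X ^ n dvd fps_of_poly (p \<circ>\<^sub>p [:c, 1:])"
    by (simp add: fps_of_poly_mult fps_of_poly_power)
next
  assume "fps_X ^ n dvd fps_of_poly (p \<circ>\<^sub>p [:c, 1:])"
  then have "[:0, 1:] ^ n dvd p \<circ>\<^sub>p [:c, 1:]"
    by (simp add: fps_X_power_dvd_iff_nth monom_1_dvd_iff' flip: monom_altdef[of 1, simplified])
  then obtain q where q: "p \<circ>\<^sub>p [:c, 1:] = [:0, 1:] ^ n * q" by (elim dvdE)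
  have "p = p \<circ>\<^sub>p [:c, 1:] \<circ>\<^sub>p [:-c, 1:]"
    by (simp add: pcompose_pCons flip: pcompose_assoc)
  also have "\<dots> = [:-c, 1:] ^ n * (q \<circ>\<^sub>p [:-c, 1:])"
    by (simp add: q pcompose_mult pcompose_hom.hom_power pcompose_pCons)
  finally show "[:-c, 1:] ^ n dvd p" by (metis dvd_triv_left)
qed

text \<open>
  If all these values vanished, the twisted Wronskian, a nonzero polynomial of degree at most
  \<open>(m + 1) * N\<close>, would vanish to too high an order at \<open>0\<close> and \<open>1\<close> together: at \<open>0\<close> because of the
  approximations, at \<open>1\<close> because of the linear relation with coefficients \<open>w j\<close>.
\<close>
lemma simultaneous_zero_estimate:
  fixes A :: "nat \<Rightarrow> complex poly" and w :: "nat \<Rightarrow> complex" and \<nu> :: "nat \<Rightarrow> nat"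
  assumes A: "\<And>j. j \<le> m \<Longrightarrow> A j \<noteq> 0" "\<And>j. j \<le> m \<Longrightarrow> degree (A j) \<le> N"
    and approx: "\<And>j. j \<in> {1..m} \<Longrightarrow> fps_X ^ (N + \<nu> j + 1) dvd
      fps_of_poly (A 0) - fps_of_poly (A j) * fps_exp (- of_nat j)"
    and w: "\<exists>j\<le>m. w j \<noteq> 0"
    and K: "N + m\<^sup>2 \<le> K + (\<Sum>j=1..m. \<nu> j)"
  shows "\<exists>t\<le>K. (\<Sum>j\<le>m. w j * poly ((twisted_pderiv (of_nat j) ^^ t) (A j)) 1) \<noteq> 0"
proof (rule ccontr)
  assume contr: "\<not> ?thesis"
  define W where "W = twisted_wronskian (Suc m) A"
  define E0 where "E0 = (\<Sum>j=1..m. N + \<nu> j + 1 - m)"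
  define E1 where "E1 = K + 1 - m"
  have W: "W \<noteq> 0" "degree W \<le> (m + 1) * N"
  proof -
    show "W \<noteq> 0"
      unfolding W_def using A(1) by (intro twisted_wronskian_nonzero) auto
    have "degree W \<le> (\<Sum>j<Suc m. degree (A j))"
      unfolding W_def using A(1) by (intro twisted_wronskian_nonzero) auto
    also have "\<dots> \<le> (\<Sum>j<Suc m. N)"
      using A(2) by (intro sum_mono) auto
    finally show "degree W \<le> (m + 1) * N" by simp
  qed
  have "fps_X ^ E0 dvd fps_of_poly W"
  proof -
    \<comment> \<open>Keeps row 0, which contributes no vanishing, and subtracts it from every other
      row, turning row \<open>i\<close> into the negative of the \<open>i\<close>-th
      approximation.\<close>
    define c where "c = (\<lambda>(i :: nat) k. if k = i then 1 else if k = 0 then -1 else 0 :: complex)"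
    define e where "e = (\<lambda>i. if i = 0 then 0 else N + \<nu> i + 1)"
    have "fps_X ^ e i dvd (\<Sum>k\<le>m. fps_const (c i k) * (fps_of_poly (A k) * fps_exp (- of_nat k)))"
      if "i \<le> m" for i
    proof (cases "i = 0")
      case False
      have "(\<Sum>k\<le>m. fps_const (c i k) * (fps_of_poly (A k) * fps_exp (- of_nat k))) =
            (\<Sum>k\<in>{0, i}. fps_const (c i k) * (fps_of_poly (A k) * fps_exp (- of_nat k)))"
        using that by (intro sum.mono_neutral_right) (auto simp: c_def)
      also have "\<dots> = - (fps_of_poly (A 0) - fps_of_poly (A i) * fps_exp (- of_nat i))"
        using False by (simp add: c_def flip: fps_const_neg)
      finally show ?thesis
        using approx[of i] that False by (simp add: e_def del: minus_diff_eq)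
    qed (simp add: e_def)
    then have "fps_X ^ (\<Sum>i\<le>m. e i - m) dvd fps_of_poly W"
      unfolding W_def by (intro fps_X_power_dvd_twisted_wronskian[where c = c]) (auto simp: c_def)
    also have "(\<Sum>i\<le>m. e i - m) = E0"
      unfolding E0_def atMost_atLeast0
      by (subst sum.atLeast_Suc_atMost) (auto simp: e_def)
    finally show ?thesis .
  qed
  then have E0: "[:-0, 1:] ^ E0 dvd W"
    using dvd_poly_iff_fps_X_power_dvd[of 0 E0 W] by (simp add: pcompose_idR)
  have "fps_X ^ E1 dvd fps_of_poly (W \<circ>\<^sub>p [:1, 1:])"
  proof -
    define B where "B = (\<lambda>j. A j \<circ>\<^sub>p [:1, 1:])"
    \<comment> \<open>Putting the relation into the row of the last nonzero weight keeps
      \<open>c\<close> lower triangular, with diagonal entry \<open>w i \<noteq> 0\<close>.\<close>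
    define i where "i = Max {j. j \<le> m \<and> w j \<noteq> 0}"
    have "i \<in> {j. j \<le> m \<and> w j \<noteq> 0}"
      unfolding i_def using w by (intro Max_in) auto
    then have i: "i \<le> m" "w i \<noteq> 0" by auto
    have after_i: "w j = 0" if "j > i" "j \<le> m" for j
      using that Max_ge[of "{j. j \<le> m \<and> w j \<noteq> 0}" j] unfolding i_def by fastforce
    define c where "c = (\<lambda>k j. if k = i then w j else if k = j then 1 else 0 :: complex)"
    define e where "e = (\<lambda>k. if k = i then K + 1 else 0)"
    have "fps_X ^ e k dvd (\<Sum>j\<le>m. fps_const (c k j) * (fps_of_poly (B j) * fps_exp (- of_nat j)))"
      if "k \<le> m" for k
    proof (cases "k = i")
      case True
      \<comment> \<open>Up to factorials, the Taylor coefficients of \<open>F\<close> at 0 are the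
        sums assumed to vanish for \<open>t \<le> K\<close>.\<close>
      define F where "F = (\<Sum>j\<le>m. fps_const (w j) * (fps_of_poly (B j) * fps_exp (- of_nat j)))"
      have "(fps_deriv ^^ t) F =
          (\<Sum>j\<le>m. fps_const (w j) * (fps_deriv ^^ t) (fps_of_poly (B j) * fps_exp (- of_nat j)))" for t
        unfolding F_def by (induction t) (simp_all add: fps_deriv_sum)
      then have "fps_nth ((fps_deriv ^^ t) F) 0 =
          (\<Sum>j\<le>m. w j * poly ((twisted_pderiv (of_nat j) ^^ t) (A j)) 1)" for t
        by (simp add: fps_sum_nth fps_deriv_funpow_times_exp B_def twisted_pderiv_shift poly_pcompose
                 flip: poly_0_coeff_0)
      then have "fps_nth F t = 0" if "t \<le> K" for t
        using contr that fps_0th_higher_deriv[of t F] by auto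
      then have "fps_X ^ (K + 1) dvd F"
        unfolding fps_X_power_dvd_iff_nth by simp
      then show ?thesis
        using True by (simp add: e_def c_def F_def del: power_Suc)
    qed (simp add: e_def)
    then have "fps_X ^ (\<Sum>i\<le>m. e i - m) dvd fps_of_poly (twisted_wronskian (Suc m) B)"
      using i after_i by (intro fps_X_power_dvd_twisted_wronskian[where c = c]) (auto simp: c_def)
    also have "(\<Sum>i\<le>m. e i - m) = (\<Sum>k\<in>{i}. e k - m)"
      using i(1) by (intro sum.mono_neutral_right) (auto simp: e_def)
    also have "\<dots> = E1"
      by (simp add: e_def E1_def)
    also have "twisted_wronskian (Suc m) B = W \<circ>\<^sub>p [:1, 1:]"
      unfolding W_def B_def by (rule twisted_wronskian_shift[symmetric])
    finally show ?thesis .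
  qed
  then have E1: "[:-1, 1:] ^ E1 dvd W"
    using dvd_poly_iff_fps_X_power_dvd[of 1 E1 W] by simp
  have "E0 + E1 \<le> degree W"
  proof -
    obtain V where V: "W = [:-0, 1:] ^ E0 * V"
      using E0 by (elim dvdE)
    have "V \<noteq> 0" "[:-0, 1 :: complex:] ^ E0 \<noteq> 0"
      using V W(1) by auto
    have "E1 \<le> Polynomial.order 1 W"
      using E1 W(1) by (simp add: order_divides)
    also have "\<dots> = Polynomial.order 1 ([:-0, 1 :: complex:] ^ E0) + Polynomial.order 1 V"
      using W(1) unfolding V by (rule Polynomial.order_mult)
    also have "Polynomial.order 1 ([:-0, 1 :: complex:] ^ E0) = 0"
      by (rule order_0I) simp
    also have "0 + Polynomial.order 1 V \<le> degree V"
      using Polynomial.order_degree[OF \<open>V \<noteq> 0\<close>] by simp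
    finally have "E1 \<le> degree V" .
    moreover have "degree W = E0 + degree V"
      unfolding V degree_mult_eq[OF \<open>[:-0, 1 :: complex:] ^ E0 \<noteq> 0\<close> \<open>V \<noteq> 0\<close>] degree_linear_power ..
    ultimately show ?thesis by simp
  qed
  \<comment> \<open>With \<open>K + 1 \<le> E1 + m\<close> and the hypothesis on \<open>K\<close>,
    this gives \<open>E0 + E1 \<ge> (m + 1) * N + 1\<close>, one more than the degree of
    \<open>W\<close> permits.\<close>
  moreover have "m * N + (\<Sum>j=1..m. \<nu> j) + m \<le> E0 + m\<^sup>2"
  proof -
    have "(\<Sum>j=1..m. N + \<nu> j + 1) \<le> (\<Sum>j=1..m. (N + \<nu> j + 1 - m) + m)"
      by (intro sum_mono) auto
    also have "\<dots> = E0 + m\<^sup>2"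
      unfolding sum.distrib E0_def by (simp add: power2_eq_square)
    also have "(\<Sum>j=1..m. N + \<nu> j + 1) = m * N + (\<Sum>j=1..m. \<nu> j) + m"
      unfolding sum.distrib by simp
    finally show ?thesis .
  qed
  moreover have "K + 1 \<le> E1 + m"
    by (simp add: E1_def)
  ultimately show False
    using W(2) K by (simp add: algebra_simps)
qed

section \<open>Approximations to powers of e\<close>

text \<open>Shifting the index by \<open>t\<close> is \<open>t\<close>-fold differentiation of the
  exponential generating function.\<close>

definition egf :: "(nat \<Rightarrow> int) \<Rightarrow> nat \<Rightarrow> complex fps" where
  "egf c t = Abs_fps (\<lambda>n. of_int (c (n + t)) / fact n)"

definition exp_egf :: "(nat \<Rightarrow> int) \<Rightarrow> nat \<Rightarrow> nat \<Rightarrow> complex fps" where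
  "exp_egf c j t = fps_exp (of_nat j) * egf c t"

text \<open>Truncation comes before differentiation, so that different \<open>t\<close> are linked
  by \<open>twisted_pderiv\<close>, as the zero estimate requires. The gap makes this agree with
  truncating the differentiated series.\<close>

definition hermite_poly :: "(nat \<Rightarrow> int) \<Rightarrow> nat \<Rightarrow> nat \<Rightarrow> nat \<Rightarrow> complex poly" where
  "hermite_poly c N j t =
     (twisted_pderiv (of_nat j) ^^ t) (\<Sum>n\<le>N. monom (fact N * fps_nth (exp_egf c j 0) n) n)"

lemma exp_egf_nth:
  "fps_nth (exp_egf c j t) n =
     of_int (\<Sum>k\<le>n. c (k + t) * int ((n choose k) * j ^ (n - k))) / fact n"
proof -
  have "fps_nth (exp_egf c j t) n = fps_nth (egf c t * fps_exp (of_nat j)) n"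
    by (simp add: exp_egf_def mult.commute)
  also have "\<dots> = (\<Sum>k\<le>n. of_int (c (k + t)) / fact k * (of_nat j ^ (n - k) / fact (n - k)))"
    by (simp add: fps_mult_nth egf_def atLeast0AtMost)
  also have "\<dots> = (\<Sum>k\<le>n. of_int (c (k + t)) * (of_nat (n choose k) * of_nat j ^ (n - k)) / fact n)"
    by (intro sum.cong refl) (simp add: binomial_fact field_simps)
  finally show ?thesis
    by (simp add: sum_divide_distrib)
qed

text \<open>The operator d/dx - j acts on exp(j x) f as exp(j x) f'. On coefficients this is the
  recursion that \<open>twisted_pderiv\<close> obeys.\<close>

lemma exp_egf_Suc:
  "fps_nth (exp_egf c j (Suc t)) n =
     of_nat (Suc n) * fps_nth (exp_egf c j t) (Suc n) - of_nat j * fps_nth (exp_egf c j t) n"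
proof -
  have "fps_deriv (egf c t) = egf c (Suc t)"
    by (rule fps_ext) (simp add: egf_def field_simps del: of_nat_Suc)
  then have "exp_egf c j (Suc t) = fps_deriv (exp_egf c j t) - fps_const (of_nat j) * exp_egf c j t"
    by (simp add: exp_egf_def algebra_simps)
  then show ?thesis by simp
qed

lemma sum_binomial_times_power: "(\<Sum>k\<le>n. (n choose k) * j ^ (n - k)) = (j + 1) ^ n"
  for j n :: nat
  using binomial[of 1 j n] by (simp add: add.commute)

lemma norm_exp_egf_nth_le:
  assumes "\<And>k. \<bar>c k\<bar> \<le> int B"
  shows "norm (fps_nth (exp_egf c j t) n) \<le> real B * (real j + 1) ^ n / fact n"
proof -
  have "\<bar>\<Sum>k\<le>n. c (k + t) * int ((n choose k) * j ^ (n - k))\<bar> \<le>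
      (\<Sum>k\<le>n. \<bar>c (k + t) * int ((n choose k) * j ^ (n - k))\<bar>)"
    by (rule sum_abs)
  also have "\<dots> \<le> (\<Sum>k\<le>n. int B * int ((n choose k) * j ^ (n - k)))"
    by (intro sum_mono) (auto simp: abs_mult intro!: mult_right_mono assms)
  also have "\<dots> = int (B * (j + 1) ^ n)"
    by (simp only: sum_binomial_times_power[symmetric] of_nat_mult of_nat_sum sum_distrib_left)
  finally have "real_of_int \<bar>\<Sum>k\<le>n. c (k + t) * int ((n choose k) * j ^ (n - k))\<bar>
      \<le> real_of_int (int (B * (j + 1) ^ n))"
    by (simp only: of_int_le_iff)
  then have "\<bar>real_of_int (\<Sum>k\<le>n. c (k + t) * int ((n choose k) * j ^ (n - k)))\<bar>
      \<le> real B * (real j + 1) ^ n"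
    by (simp add: add.commute)
  then show ?thesis
    unfolding exp_egf_nth norm_divide norm_of_int norm_fact by (intro divide_right_mono) auto
qed

lemma degree_hermite_poly: "degree (hermite_poly c N j t) \<le> N"
  unfolding hermite_poly_def
  by (intro degree_funpow_twisted_pderiv_le degree_sum_le)
     (auto intro: order.trans[OF degree_monom_le])

text \<open>Both sides obey the same recursion. It looks at index \<open>n + 1\<close>, so every
  derivative costs one index at the upper end of the gap.\<close>

lemma coeff_hermite_poly:
  assumes gap: "\<forall>n\<in>{N+1..N+\<nu>}. fps_nth (exp_egf c j 0) n = 0"
  assumes "t \<le> \<nu>" "n \<le> N + \<nu> - t"
  shows "coeff (hermite_poly c N j t) n = fact N * fps_nth (exp_egf c j t) n"
  using assms(2,3)
proof (induction t arbitrary: n)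
  case 0
  then show ?case
    using gap by (auto simp: hermite_poly_def coeff_sum)
next
  case (Suc t)
  have "hermite_poly c N j (Suc t) = twisted_pderiv (of_nat j) (hermite_poly c N j t)"
    by (simp add: hermite_poly_def)
  then have "coeff (hermite_poly c N j (Suc t)) n =
      of_nat (Suc n) * coeff (hermite_poly c N j t) (Suc n) - of_nat j * coeff (hermite_poly c N j t) n"
    by (simp add: twisted_pderiv_def coeff_pderiv)
  then show ?case
    using Suc.prems Suc.IH[of n] Suc.IH[of "Suc n"]
    by (simp add: exp_egf_Suc algebra_simps)
qed

lemma poly_1_eq_sum_coeff:
  fixes p :: "'a :: comm_semiring_1 poly"
  assumes "degree p < n"
  shows "poly p 1 = (\<Sum>i<n. coeff p i)"
proof -
  have "poly p 1 = (\<Sum>i\<le>degree p. coeff p i)"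
    by (simp add: poly_altdef)
  also have "\<dots> = (\<Sum>i<n. coeff p i)"
    using assms by (intro sum.mono_neutral_left) (auto simp: coeff_eq_0)
  finally show ?thesis .
qed

text \<open>Only degrees \<open>n \<le> N\<close> contribute, and there the factor
  \<open>fact N\<close> clears the denominator \<open>fact n\<close>.\<close>

lemma poly_hermite_poly_int:
  assumes "\<forall>n\<in>{N+1..N+\<nu>}. fps_nth (exp_egf c j 0) n = 0" and "t \<le> \<nu>"
  shows "poly (hermite_poly c N j t) 1 \<in> \<int>"
proof -
  have "poly (hermite_poly c N j t) 1 = (\<Sum>n<Suc N. coeff (hermite_poly c N j t) n)"
    using degree_hermite_poly[of c N j t] by (intro poly_1_eq_sum_coeff) simp
  also have "\<dots> = (\<Sum>n<Suc N. fact N * fps_nth (exp_egf c j t) n)"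
    using assms(2) by (intro sum.cong refl coeff_hermite_poly[OF assms(1)]) auto
  also have "\<dots> \<in> \<int>"
  proof (intro Ints_sum)
    fix n assume "n \<in> {..<Suc N}"
    then have "(fact n :: int) dvd fact N" by (intro fact_dvd) simp
    then obtain z where z: "fact N = fact n * (z :: int)" by (elim dvdE)
    have "(fact N :: complex) = of_int (fact N)" by simp
    also have "\<dots> = fact n * of_int z" unfolding z by simp
    finally have N: "(fact N :: complex) = fact n * of_int z" .
    show "fact N * fps_nth (exp_egf c j t) n \<in> \<int>"
      unfolding exp_egf_nth N by (simp flip: of_int_mult del: of_int_sum)
  qed
  finally show ?thesis .
qed

lemma fact_times_power_le: "fact N * real N ^ r \<le> fact (N + r)"
proof (induction r)
  case (Suc r)
  have "fact N * real N ^ Suc r = real N * (fact N * real N ^ r)" by simp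
  also have "\<dots> \<le> real (Suc (N + r)) * fact (N + r)"
    using Suc by (intro mult_mono) auto
  finally show ?case by simp
qed simp

text \<open>
  \<open>P j t\<close> is the truncation at degree \<open>N\<close> of \<open>N! exp (j x)\<close> times the \<open>t\<close>-th derivative of
  \<open>\<Sum>k. c k * x ^ k / k!\<close>; the vanishing of the next \<open>\<nu> j - t\<close> coefficients makes the error at \<open>x = 1\<close> small.
\<close>
locale hermite_system =
  fixes c :: "nat \<Rightarrow> int" and N m B :: nat and \<nu> :: "nat \<Rightarrow> nat"
  assumes c_zero: "\<And>k. k > N \<Longrightarrow> c k = 0"
    and c_nonzero: "\<exists>k. c k \<noteq> 0"
    and c_bound: "\<And>k. \<bar>c k\<bar> \<le> int B"
    and gap: "\<And>j. j \<in> {1..m} \<Longrightarrow> \<forall>n\<in>{N+1..N+\<nu> j}. fps_nth (exp_egf c j 0) n = 0"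
    and N_ge: "N \<ge> 2 * (m + 1)"
    and \<nu>_less: "\<And>j. j \<in> {1..m} \<Longrightarrow> \<nu> j < N"
begin

abbreviation P where "P \<equiv> hermite_poly c N"

text \<open>The series for \<open>j = 0\<close> ends at degree \<open>N\<close>, so its gap has any
  length and \<open>P 0 t\<close> is available for every \<open>t\<close>.\<close>

lemma gap_0: "\<forall>n\<in>{N+1..N+k}. fps_nth (exp_egf c 0 0) n = 0"
  by (simp add: exp_egf_def egf_def c_zero)

lemma coeff_P_0: "coeff (P 0 t) n = fact N * fps_nth (exp_egf c 0 t) n"
  using coeff_hermite_poly[OF gap_0[of "t + n"], of t n] by simp

lemma fps_of_poly_P_0: "fps_exp (of_nat j) * fps_of_poly (P 0 t) = fps_const (fact N) * exp_egf c j t"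
proof -
  have "fps_of_poly (P 0 t) = fps_const (fact N) * egf c t"
    by (rule fps_ext) (simp add: coeff_P_0 exp_egf_def)
  then show ?thesis
    by (simp add: exp_egf_def mult_ac)
qed

text \<open>Since exp(j x) has constant term 1, the lowest nonzero \<open>c k\<close> survives in
  the coefficient of degree \<open>k\<close>.\<close>

lemma P_nonzero: "P j 0 \<noteq> 0"
proof -
  define k where "k = (LEAST k. c k \<noteq> 0)"
  have k: "c k \<noteq> 0"
    unfolding k_def using c_nonzero by (rule LeastI_ex)
  have least: "c i = 0" if "i < k" for i
    using that not_less_Least unfolding k_def by blast
  have "k \<le> N"
    using k c_zero[of k] by (meson not_le)
  have "coeff (P j 0) k = fact N * fps_nth (exp_egf c j 0) k"
    using coeff_hermite_poly[of N 0 c j 0 k] \<open>k \<le> N\<close> by simp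
  also have "fps_nth (exp_egf c j 0) k = of_int (\<Sum>i\<in>{k}. c i * int ((k choose i) * j ^ (k - i))) / fact k"
    unfolding exp_egf_nth
    by (intro arg_cong[of _ _ "\<lambda>x. of_int x / _"] sum.mono_neutral_cong_right) (auto intro!: least)
  finally have "coeff (P j 0) k \<noteq> 0"
    using k by simp
  then show ?thesis by auto
qed

lemma P_int:
  assumes "j \<le> m" "j = 0 \<or> t \<le> \<nu> j"
  shows "poly (P j t) 1 \<in> \<int>"
proof (cases "j = 0")
  case True
  then show ?thesis
    using poly_hermite_poly_int[OF gap_0[of t], of t] by simp
next
  case False
  then show ?thesis
    using assms by (intro poly_hermite_poly_int[OF gap]) auto
qed

lemma P_0_bound: "norm (poly (P 0 t) 1) \<le> 3 * real B * fact N"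
proof -
  have "poly (P 0 t) 1 = (\<Sum>n<Suc N. fact N * fps_nth (exp_egf c 0 t) n)"
    using degree_hermite_poly[of c N 0 t] by (simp add: poly_1_eq_sum_coeff[of _ "Suc N"] coeff_P_0)
  also have "norm \<dots> \<le> (\<Sum>n<Suc N. fact N * (real B * (1 / fact n)))"
  proof (intro sum_norm_le)
    show "norm (fact N * fps_nth (exp_egf c 0 t) n) \<le> fact N * (real B * (1 / fact n))" for n
      using norm_exp_egf_nth_le[of c B 0 t n] c_bound
      unfolding norm_mult norm_fact by (intro mult_left_mono) auto
  qed
  also have "\<dots> = fact N * real B * (\<Sum>n<Suc N. 1 / fact n)"
    unfolding sum_distrib_left by (intro sum.cong refl) simp
  also have "\<dots> \<le> fact N * real B * 3"
  proof (intro mult_left_mono)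
    have "(\<lambda>n. 1 / fact n) sums exp (1 :: real)"
      using exp_converges[of "1 :: real"] by (simp add: field_simps)
    then have "(\<Sum>n<Suc N. 1 / fact n) \<le> exp (1 :: real)"
      using sum_le_suminf[of "\<lambda>n. 1 / fact n :: real" "{..<Suc N}"] by (auto simp: sums_iff)
    also have "\<dots> \<le> 3" by (rule exp_le)
    finally show "(\<Sum>n<Suc N. 1 / fact n) \<le> (3 :: real)" .
  qed auto
  finally show ?thesis by (simp only: mult_ac)
qed

text \<open>Below degree \<open>q\<close> the series has exactly the coefficients of
  \<open>P j t\<close>, so the error is the tail from \<open>q\<close> on. There
  \<open>fact N / fact (n + q)\<close> supplies the power of \<open>N\<close>.\<close>

lemma remainder_bound:
  assumes j: "j \<in> {1..m}" and t: "t \<le> \<nu> j"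
  shows "norm (exp (of_nat j) * poly (P 0 t) 1 - poly (P j t) 1) \<le>
           2 * real B * (real m + 1) ^ (2 * N) / real N ^ (\<nu> j - t + 1)"
proof -
  define q where "q = N + \<nu> j - t + 1"
  define f where "f = (\<lambda>n. fact N * fps_nth (exp_egf c j t) n)"
  define g where "g = (\<lambda>n. real B * (real m + 1) ^ q / real N ^ (\<nu> j - t + 1) * (1 / 2) ^ n)"
  have N0: "N > 0" using N_ge by simp
  have q: "q = N + (\<nu> j - t + 1)" "q \<le> 2 * N"
    using t \<nu>_less[OF j] by (auto simp: q_def)
  have "f sums (exp (of_nat j) * poly (P 0 t) 1)"
  proof -
    have "(\<lambda>n. fps_nth (fps_exp (of_nat j) * fps_of_poly (P 0 t)) n * 1 ^ n) sums
        eval_fps (fps_exp (of_nat j) * fps_of_poly (P 0 t)) 1"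
      by (rule sums_eval_fps)
         (auto intro!: less_le_trans[OF _ fps_conv_radius_mult])
    also have "eval_fps (fps_exp (of_nat j) * fps_of_poly (P 0 t)) 1 = exp (of_nat j) * poly (P 0 t) 1"
      by (subst eval_fps_mult) auto
    finally show ?thesis
      by (simp add: f_def fps_of_poly_P_0)
  qed
  then have "(\<lambda>n. f (n + q)) sums (exp (of_nat j) * poly (P 0 t) 1 - (\<Sum>n<q. f n))"
    by (rule sums_split_initial_segment)
  also have "(\<Sum>n<q. f n) = (\<Sum>n<q. coeff (P j t) n)"
    using t by (intro sum.cong refl) (simp add: f_def q_def coeff_hermite_poly[OF gap[OF j]])
  also have "\<dots> = poly (P j t) 1"
    using degree_hermite_poly[of c N j t] q by (intro poly_1_eq_sum_coeff[symmetric]) linarith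
  finally have sums: "(\<lambda>n. f (n + q)) sums (exp (of_nat j) * poly (P 0 t) 1 - poly (P j t) 1)" .
  have "norm (f (n + q)) \<le> g n" for n
  proof -
    define r where "r = \<nu> j - t + 1"
    have "norm (f (n + q)) \<le> fact N * (real B * (real j + 1) ^ (n + q) / fact (n + q))"
      unfolding f_def norm_mult norm_fact
      by (intro mult_left_mono norm_exp_egf_nth_le c_bound) auto
    also have "\<dots> \<le> fact N * (real B * (real m + 1) ^ (n + q) / (fact N * real N ^ (r + n)))"
      using fact_times_power_le[of N "r + n"] j N0
      by (intro mult_left_mono frac_le mult_left_mono power_mono) (auto simp: q r_def ac_simps)
    also have "\<dots> = real B * (real m + 1) ^ q / real N ^ r * ((real m + 1) / real N) ^ n"
      by (simp add: power_add power_divide)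
    \<comment> \<open>\<open>N_ge\<close> makes the ratio \<open>(m + 1) / N\<close> at most 1/2,
      whence the factor 2 in the bound.\<close>
    also have "\<dots> \<le> g n"
      unfolding g_def r_def using N_ge N0
      by (intro mult_left_mono power_mono) (auto simp: field_simps)
    finally show ?thesis .
  qed
  moreover have g: "g sums (real B * (real m + 1) ^ q / real N ^ (\<nu> j - t + 1) * 2)"
    unfolding g_def using geometric_sums[of "1 / 2 :: real"] by (intro sums_mult) simp
  ultimately have "norm (exp (of_nat j) * poly (P 0 t) 1 - poly (P j t) 1) \<le>
      real B * (real m + 1) ^ q / real N ^ (\<nu> j - t + 1) * 2"
    using norm_suminf_le[of "\<lambda>n. f (n + q)" g] sums by (simp add: sums_iff)
  also have "\<dots> \<le> real B * (real m + 1) ^ (2 * N) / real N ^ (\<nu> j - t + 1) * 2"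
    using q(2) by (intro mult_right_mono divide_right_mono mult_left_mono power_increasing) auto
  finally show ?thesis by (simp add: mult_ac)
qed

lemma exists_nonzero_combination:
  fixes w :: "nat \<Rightarrow> complex"
  assumes "\<exists>j\<le>m. w j \<noteq> 0" and "N + m\<^sup>2 \<le> K + (\<Sum>j=1..m. \<nu> j)"
  shows "\<exists>t\<le>K. (\<Sum>j\<le>m. w j * poly (P j t) 1) \<noteq> 0"
proof -
  have P: "P j t = (twisted_pderiv (of_nat j) ^^ t) (P j 0)" for j t
    by (simp add: hermite_poly_def)
  have "fps_X ^ (N + \<nu> j + 1) dvd fps_of_poly (P 0 0) - fps_of_poly (P j 0) * fps_exp (- of_nat j)"
    if j: "j \<in> {1..m}" for j
  proof -
    have "fps_exp (- of_nat j :: complex) * fps_exp (of_nat j) = 1"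
      by (simp flip: fps_exp_add_mult)
    then have "fps_of_poly (P 0 0) - fps_of_poly (P j 0) * fps_exp (- of_nat j) =
        fps_exp (- of_nat j) * (fps_exp (of_nat j) * fps_of_poly (P 0 0) - fps_of_poly (P j 0))"
      by (simp add: algebra_simps flip: mult.assoc)
    moreover have "fps_X ^ (N + \<nu> j + 1) dvd fps_exp (of_nat j) * fps_of_poly (P 0 0) - fps_of_poly (P j 0)"
      unfolding fps_X_power_dvd_iff_nth fps_of_poly_P_0
      using coeff_hermite_poly[OF gap[OF j], of 0] by (simp add: less_Suc_eq_le)
    ultimately show ?thesis by simp
  qed
  then show ?thesis
    using simultaneous_zero_estimate[of m "\<lambda>j. P j 0" N \<nu> w K] P_nonzero degree_hermite_poly assms
    by (simp flip: P)
qed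

end

text \<open>There are \<open>N + 1\<close> unknowns and one equation for each pair of
  \<open>j\<close> and an index in its gap. Row sums are at most \<open>(j + 1) ^ n\<close> by the
  binomial theorem, and \<open>n \<le> 2 * N\<close>.\<close>

lemma exists_hermite_system:
  assumes N: "N \<ge> 2 * (m + 1)" and \<nu>: "\<And>j. j \<in> {1..m} \<Longrightarrow> \<nu> j < N"
    and M: "(\<Sum>j=1..m. \<nu> j) \<le> N"
    and B: "((m + 1) ^ (2 * N)) ^ (\<Sum>j=1..m. \<nu> j) < (B + 1) ^ (N + 1 - (\<Sum>j=1..m. \<nu> j))"
  shows "\<exists>c. hermite_system c N m B \<nu>"
proof -
  define I where "I = (SIGMA j:{1..m}. {N+1..N+\<nu> j})"
  define a where "a = (\<lambda>(j, n) k. (n choose k) * j ^ (n - k))"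
  have card_I: "card I = (\<Sum>j=1..m. \<nu> j)"
    by (simp add: I_def)
  have rows: "(\<Sum>k\<in>{..N}. a i k) \<le> (m + 1) ^ (2 * N)" if "i \<in> I" for i
  proof -
    obtain j n where jn: "i = (j, n)" by (cases i)
    with that have i: "i = (j, n)" "j \<in> {1..m}" "n \<in> {N+1..N+\<nu> j}"
      by (simp_all add: I_def)
    have "(\<Sum>k\<in>{..N}. a i k) \<le> (\<Sum>k\<le>n. (n choose k) * j ^ (n - k))"
      using i by (auto simp: a_def intro!: sum_mono2)
    also have "\<dots> = (j + 1) ^ n"
      by (rule sum_binomial_times_power)
    also have "\<dots> \<le> (m + 1) ^ n"
      using i by (intro power_mono) auto
    also have "\<dots> \<le> (m + 1) ^ (2 * N)"
      using i \<nu>[of j] by (intro power_increasing) auto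
    finally show ?thesis .
  qed
  obtain x where x: "\<exists>k\<in>{..N}. x k \<noteq> 0" "\<And>k. k \<in> {..N} \<Longrightarrow> \<bar>x k\<bar> \<le> int B"
    "\<And>i. i \<in> I \<Longrightarrow> (\<Sum>k\<in>{..N}. int (a i k) * x k) = 0"
    by (rule siegel_nonneg[of I "{..N}" "(m + 1) ^ (2 * N)" a B])
       (use rows M B card_I in \<open>auto simp: I_def\<close>)
  define c where "c = (\<lambda>k. if k \<le> N then x k else 0)"
  have "hermite_system c N m B \<nu>"
  proof
    show "c k = 0" if "k > N" for k using that by (simp add: c_def)
    show "\<exists>k. c k \<noteq> 0" using x(1) by (auto simp: c_def)
    show "\<bar>c k\<bar> \<le> int B" for k using x(2) by (simp add: c_def)
    show "\<forall>n\<in>{N+1..N+\<nu> j}. fps_nth (exp_egf c j 0) n = 0" if "j \<in> {1..m}" for j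
    proof
      fix n assume n: "n \<in> {N+1..N+\<nu> j}"
      have "(\<Sum>k\<le>n. c (k + 0) * int ((n choose k) * j ^ (n - k))) = (\<Sum>k\<in>{..N}. int (a (j, n) k) * x k)"
        using n by (intro sum.mono_neutral_cong_right) (auto simp: c_def a_def)
      also have "\<dots> = 0"
        using that n by (intro x(3)) (auto simp: I_def)
      finally show "fps_nth (exp_egf c j 0) n = 0" by (simp add: exp_egf_nth)
    qed
  qed (use N \<nu> in auto)
  then show ?thesis by blast
qed

section \<open>Choice of parameters\<close>

text \<open>The hypothesis \<open>small\<close> makes each error term at most
  \<open>1 / (2 * m)\<close>, so half of the integer combination's size 1 remains; dividing by the
  bound \<open>3 * B * fact N\<close> for \<open>P 0 t\<close> gives the 6. The condition
  \<open>k \<le> \<nu> j\<close> keeps all derivatives used integral at 1.\<close>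

lemma cmod_lower_bound_of_parameters:
  fixes \<beta> :: "nat \<Rightarrow> complex"
  assumes K: "K = \<rat> \<or> imaginary_quadratic_field K"
    and \<beta>: "\<forall>i\<le>m. \<beta> i \<in> ring_of_integers K" "\<exists>i\<le>m. \<beta> i \<noteq> 0"
    and N: "N \<ge> 2 * (m + 1)" and \<nu>: "\<And>j. j \<in> {1..m} \<Longrightarrow> \<nu> j < N"
    and M: "(\<Sum>j=1..m. \<nu> j) \<le> N"
    and B: "((m + 1) ^ (2 * N)) ^ (\<Sum>j=1..m. \<nu> j) < (B + 1) ^ (N + 1 - (\<Sum>j=1..m. \<nu> j))"
    and k: "N + m\<^sup>2 \<le> k + (\<Sum>j=1..m. \<nu> j)" "\<And>j. j \<in> {1..m} \<Longrightarrow> k \<le> \<nu> j"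
    and small: "\<And>j. j \<in> {1..m} \<Longrightarrow>
      4 * real m * real B * (real m + 1) ^ (2 * N) * max 1 (cmod (\<beta> j)) \<le> real N ^ (\<nu> j - k + 1)"
  shows "cmod (\<Sum>i\<le>m. \<beta> i * exp (of_nat i)) \<ge> 1 / (6 * real B * fact N)"
proof -
  obtain c where "hermite_system c N m B \<nu>"
    using exists_hermite_system[OF N \<nu> M B] by blast
  then interpret hermite_system c N m B \<nu> .
  obtain t where t: "t \<le> k" "(\<Sum>j\<le>m. \<beta> j * poly (P j t) 1) \<noteq> 0"
    using exists_nonzero_combination[OF \<beta>(2) k(1)] by blast
  define \<Lambda> where "\<Lambda> = (\<Sum>i\<le>m. \<beta> i * exp (of_nat i))"
  define p where "p = (\<lambda>j. poly (P j t) 1)"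
  define r where "r = (\<lambda>j. exp (of_nat j) * p 0 - p j)"
  have N0: "N > 0" using N by simp
  have "\<exists>z. p j = of_int z" if "j \<le> m" for j
    using P_int[of j t] that t(1) k(2)[of j] unfolding p_def
    by (metis Ints_cases One_nat_def Suc_leI atLeastAtMost_iff gr0I order.trans)
  then obtain b where b: "\<And>j. j \<le> m \<Longrightarrow> p j = of_int (b j)"
    by metis
  have "1 \<le> cmod (\<Sum>j\<le>m. \<beta> j * p j)"
  proof -
    have eq: "(\<Sum>j\<le>m. \<beta> j * p j) = (\<Sum>j\<le>m. \<beta> j * of_int (b j))"
      by (intro sum.cong) (auto simp: b)
    have "(\<Sum>j\<le>m. \<beta> j * of_int (b j)) \<noteq> 0"
      using t(2) unfolding eq[symmetric] by (simp add: p_def)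
    then show ?thesis
      unfolding eq by (rule norm_int_combination_ge_1[OF K \<beta>(1)])
  qed
  also have "(\<Sum>j\<le>m. \<beta> j * p j) = p 0 * \<Lambda> - (\<Sum>j\<le>m. \<beta> j * r j)"
    by (simp add: \<Lambda>_def r_def sum_distrib_left sum_subtractf algebra_simps)
  also have "(\<Sum>j\<le>m. \<beta> j * r j) = (\<Sum>j=1..m. \<beta> j * r j)"
    unfolding atMost_atLeast0 by (subst sum.atLeast_Suc_atMost) (auto simp: r_def)
  also have "cmod (p 0 * \<Lambda> - (\<Sum>j=1..m. \<beta> j * r j)) \<le>
      cmod (p 0 * \<Lambda>) + cmod (\<Sum>j=1..m. \<beta> j * r j)"
    by (rule norm_triangle_ineq4)
  also have "cmod (\<Sum>j=1..m. \<beta> j * r j) \<le> (\<Sum>j=1..m. 1 / (2 * real m))"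
  proof (intro sum_norm_le)
    fix j assume j: "j \<in> {1..m}"
    define Q where "Q = 2 * real B * (real m + 1) ^ (2 * N)"
    have Q: "Q \<ge> 0" by (simp add: Q_def)
    have "cmod (r j) \<le> Q / real N ^ (\<nu> j - t + 1)"
      using remainder_bound[OF j, of t] t(1) k(2)[OF j] by (simp add: r_def p_def Q_def)
    also have "\<dots> \<le> Q / real N ^ (\<nu> j - k + 1)"
      using Q N0 t(1) by (intro divide_left_mono power_increasing) auto
    finally have "cmod (\<beta> j * r j) \<le> max 1 (cmod (\<beta> j)) * (Q / real N ^ (\<nu> j - k + 1))"
      unfolding norm_mult by (intro mult_mono) auto
    also have "\<dots> \<le> 1 / (2 * real m)"
    proof -
      have "max 1 (cmod (\<beta> j)) * Q * (2 * real m) \<le> real N ^ (\<nu> j - k + 1)"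
        using small[OF j] by (simp add: Q_def mult_ac)
      then show ?thesis
        using j N0 by (simp add: field_simps)
    qed
    finally show "cmod (\<beta> j * r j) \<le> 1 / (2 * real m)" .
  qed
  also have "(\<Sum>j=1..m. 1 / (2 * real m)) \<le> 1 / 2" by simp
  finally have "1 / 2 \<le> cmod (p 0) * cmod \<Lambda>" by (simp add: norm_mult)
  also have "\<dots> \<le> 3 * real B * fact N * cmod \<Lambda>"
    using P_0_bound[of t] by (intro mult_right_mono) (auto simp: p_def)
  finally have *: "1 / 2 \<le> 3 * real B * fact N * cmod \<Lambda>" .
  then have "B > 0" by (cases "B = 0") auto
  with * show ?thesis
    unfolding \<Lambda>_def by (simp add: field_simps)
qed

text \<open>Rounded gap lengths need not exhaust their budget; the whole surplus goes to index
  1.\<close>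

lemma exists_larger_with_sum:
  fixes r :: "nat \<Rightarrow> nat"
  assumes "1 \<le> m" "(\<Sum>j=1..m. r j) \<le> M"
  shows "\<exists>\<nu>. (\<forall>j. r j \<le> \<nu> j) \<and> (\<Sum>j=1..m. \<nu> j) = M"
proof (intro exI conjI)
  let ?\<nu> = "r(1 := r 1 + (M - (\<Sum>j=1..m. r j)))"
  show "\<forall>j. r j \<le> ?\<nu> j" by simp
  have "(\<Sum>j=1..m. ?\<nu> j) = ?\<nu> 1 + (\<Sum>j=2..m. ?\<nu> j)"
    using assms(1) by (subst sum.atLeast_Suc_atMost) (auto simp: numeral_2_eq_2)
  also have "(\<Sum>j=2..m. ?\<nu> j) = (\<Sum>j=2..m. r j)"
    by (intro sum.cong) auto
  also have "?\<nu> 1 + (\<Sum>j=2..m. r j) = (M - (\<Sum>j=1..m. r j)) + (\<Sum>j=1..m. r j)"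
    using assms(1) sum.atLeast_Suc_atMost[of 1 m r] by (simp add: numeral_2_eq_2)
  also have "\<dots> = M" using assms(2) by simp
  finally show "(\<Sum>j=1..m. ?\<nu> j) = M" .
qed

section \<open>Numerical estimates for the parameters\<close>

text \<open>
  Here \<open>H = ln h\<close> and \<open>X = ln ln h\<close>. With \<open>\<gamma> = 3/2 * \<theta>\<close>, about \<open>\<gamma> * N\<close> of the \<open>N + 1\<close> coefficients are
  left free, so that Siegel's lemma costs a factor \<open>exp (2 * N * lam / \<gamma>)\<close>, while the gaps available
  for the heights add up to about \<open>(1 - (m + 1) * \<gamma>) * N\<close> only. The choice of \<open>\<theta>\<close> balances these two
  losses, and \<open>b\<close> enlarges \<open>N\<close> beyond \<open>H / X\<close> enough to absorb them.
\<close>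
locale parameters =
  fixes m :: nat and H X lam \<theta> :: real
  assumes m: "m \<ge> 2" and H: "H = exp X"
    and lam_def: "lam = ln (real m + 1)"
    and X: "X \<ge> (real m)\<^sup>2 * (81 * lam + 20)"
    and \<theta>_def: "\<theta> = sqrt (lam / X)"
begin

text \<open>Two demands meet here: \<open>main_inequality\<close> needs \<open>b\<close> to exceed
  \<open>q + b * q * \<theta>\<close> with some room, where \<open>q\<close> is about 17/6 * m and m
  = 2 is nearly tight, while \<open>final_inequality\<close> needs
  \<open>b + 4/3 * (1 + b * \<theta>) < 4 + 7 * m\<close>.\<close>

definition b :: real where "b = 7 * real m + 1"
definition N0 :: real where "N0 = (1 + b * \<theta>) * H / X"
definition N :: nat where "N = nat \<lfloor>N0\<rfloor>"

lemma lam_ge_1: "lam \<ge> 1"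
proof -
  have "exp 1 \<le> real m + 1" using exp_le m by linarith
  then show ?thesis unfolding lam_def by (subst ln_ge_iff) auto
qed

lemma X_ge: "X \<ge> 101 * (real m)\<^sup>2" "X \<ge> 81 * (real m)\<^sup>2 * lam" "X \<ge> 404"
proof -
  have "(real m)\<^sup>2 * (81 * lam + 20) \<ge> (real m)\<^sup>2 * 101"
    using lam_ge_1 by (intro mult_left_mono) auto
  with X show 1: "X \<ge> 101 * (real m)\<^sup>2" by simp
  show "X \<ge> 81 * (real m)\<^sup>2 * lam" proof -
    have "(real m)\<^sup>2 * (81 * lam + 20) = 81 * (real m)\<^sup>2 * lam + 20 * (real m)\<^sup>2"
      by (simp add: algebra_simps)
    with X zero_le_power2[of "real m"] show ?thesis by linarith
  qed
  have "(real m)\<^sup>2 \<ge> 2\<^sup>2" using m by (intro power_mono) auto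
  with 1 show "X \<ge> 404" by simp
qed

lemma \<theta>_sq: "\<theta>\<^sup>2 = lam / X"
  unfolding \<theta>_def using lam_ge_1 X_ge by simp

lemma \<theta>_pos: "\<theta> > 0"
  unfolding \<theta>_def using lam_ge_1 X_ge by simp

text \<open>The constant 81 in the lower bound for \<open>X\<close> yields this 1/9, which tames all
  terms quadratic in \<open>\<theta>\<close>.\<close>

lemma m\<theta>_le: "real m * \<theta> \<le> 1 / 9"
proof -
  have "(real m * \<theta>)\<^sup>2 = (real m)\<^sup>2 * lam / X"
    by (simp add: power_mult_distrib \<theta>_sq)
  also have "\<dots> \<le> 1 / 81"
    using X_ge by (simp add: field_simps)
  finally have "(real m * \<theta>)\<^sup>2 \<le> (1 / 9)\<^sup>2" by (simp add: power2_eq_square)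
  then show ?thesis by (rule power2_le_imp_le) simp
qed

lemma \<theta>_le: "\<theta> \<le> 1 / 18"
proof -
  have "2 * \<theta> \<le> real m * \<theta>" using m \<theta>_pos by (intro mult_right_mono) auto
  then show ?thesis using m\<theta>_le by simp
qed

lemma \<theta>_ge: "\<theta> \<ge> 1 / sqrt X"
proof -
  have "1 / sqrt X \<le> sqrt lam / sqrt X"
    using lam_ge_1 X_ge by (intro divide_right_mono) auto
  then show ?thesis by (simp add: \<theta>_def real_sqrt_divide)
qed

lemma b\<theta>: "0 < b * \<theta>" "b * \<theta> \<le> 1" "1 / X \<le> b * \<theta>"
proof -
  show "0 < b * \<theta>" using \<theta>_pos by (simp add: b_def)
  show "b * \<theta> \<le> 1" using m\<theta>_le \<theta>_le by (simp add: b_def algebra_simps)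
  have "sqrt X \<le> X" using X_ge by (simp add: real_sqrt_le_iff' real_le_lsqrt power2_eq_square)
  then have "1 / X \<le> 1 / sqrt X" using X_ge by (intro divide_left_mono) auto
  also have "\<dots> \<le> \<theta>" by (rule \<theta>_ge)
  also have "\<dots> \<le> b * \<theta>" using \<theta>_pos by (simp add: b_def)
  finally show "1 / X \<le> b * \<theta>" .
qed

lemma H_ge: "H \<ge> X ^ 4"
proof -
  have "X ^ 5 / fact 5 \<le> (\<Sum>n<6. X ^ n / fact n)"
    using X_ge by (intro member_le_sum[where f = "\<lambda>n. X ^ n / fact n"]) auto
  also have "\<dots> \<le> exp X"
    using X_ge exp_converges[of X] sum_le_suminf[of "\<lambda>n. X ^ n / fact n" "{..<6}"]
    by (auto simp: sums_iff divide_inverse mult.commute)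
  finally have "X ^ 5 / 120 \<le> H" by (simp add: H fact_numeral)
  moreover have "X ^ 4 * 120 \<le> X ^ 4 * X"
    using X_ge by (intro mult_left_mono) auto
  ultimately show ?thesis by (simp add: eval_nat_numeral)
qed

text \<open>The extra 1 pays for the floor in \<open>N\<close>, so that still
  \<open>N \<ge> H / X\<close>.\<close>

lemma N0_ge: "N0 \<ge> H / X + 1"
proof -
  have "X * X \<le> X ^ 4" using power_increasing[of 2 4 X] X_ge by (simp add: power2_eq_square)
  then have "X * X \<le> H" using H_ge by simp
  then have "X \<le> H / X" using X_ge by (simp add: field_simps)
  then have "(1 / X) * X \<le> (b * \<theta>) * (H / X)"
    using X_ge b\<theta> by (intro mult_mono) auto
  then show ?thesis using X_ge by (simp add: N0_def field_simps)
qed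

lemma N_bounds: "real N \<le> N0" "N0 \<le> real N + 1" "real N \<ge> H / X" "real N \<ge> X ^ 3"
proof -
  have N0: "N0 \<ge> H / X + 1" "0 \<le> H / X" using N0_ge X_ge by (auto simp: H)
  then show 1: "real N \<le> N0" "N0 \<le> real N + 1" unfolding N_def by linarith+
  then show 2: "real N \<ge> H / X" using N0 by linarith
  have "X ^ 3 \<le> H / X"
    using H_ge X_ge by (simp add: field_simps eval_nat_numeral)
  then show "real N \<ge> X ^ 3" using 2 by linarith
qed

lemma N_pos: "real N \<ge> 404" "N > 0"
proof -
  have "X * 1 \<le> X * X\<^sup>2" using X_ge by (intro mult_left_mono) auto
  then have "X \<le> X ^ 3" by (simp add: eval_nat_numeral)
  then show "real N \<ge> 404" using N_bounds X_ge by linarith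
  then show "N > 0" by (cases N) auto
qed

text \<open>As \<open>ln (H / X) = X - ln X\<close>, the loss is at most \<open>ln X\<close>, which
  is below \<open>sqrt X\<close>; the factor \<open>1 + \<theta>\<close> absorbs it because
  \<open>\<theta> \<ge> 1 / sqrt X\<close>.\<close>

lemma ln_N: "X \<le> (1 + \<theta>) * ln N" "ln N \<le> X" "ln N \<ge> 1"
proof -
  have lnHX: "ln (H / X) = X - ln X" using X_ge by (simp add: H ln_div)
  have "ln (H / X) \<le> ln N"
    using N_bounds N_pos X_ge by (subst ln_le_cancel_iff) (auto simp: H)
  then have lower: "X - ln X \<le> ln N" by (simp add: lnHX)
  define y where "y = sqrt X"
  have y: "y > 0" "y\<^sup>2 = X" "y \<ge> 20"
  proof -
    show "y > 0" "y\<^sup>2 = X" using X_ge by (auto simp: y_def)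
    have "20\<^sup>2 \<le> X" using X_ge by simp
    then show "y \<ge> 20" unfolding y_def by (rule real_le_rsqrt)
  qed
  \<comment> \<open>Tangent to the logarithm at 5/2, combined with
    \<open>ln (5/2) \<le> 1\<close>.\<close>
  have "ln y \<le> y * (4 / 10)"
  proof -
    define a where "a = ln (y / (5 / 2))"
    define d where "d = ln (5 / 2 :: real)"
    have "a \<le> y / (5 / 2) - 1" unfolding a_def using y by (intro ln_le_minus_one) auto
    moreover have "d \<le> 1"
    proof -
      have "5 / 2 \<le> exp (1 :: real)" using exp_lower_Taylor_quadratic[of 1] by simp
      then have "ln (5 / 2 :: real) \<le> ln (exp 1)" by (subst ln_le_cancel_iff) auto
      then show ?thesis by (simp add: d_def)
    qed
    moreover have "a = ln y - d"
      unfolding a_def d_def using y by (intro ln_divide_pos) auto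
    ultimately show ?thesis by simp
  qed
  moreover have "ln X = 2 * ln y" using y by (simp add: ln_realpow flip: y(2))
  ultimately have lnX: "ln X \<le> y * (8 / 10)" by simp
  have "X \<le> (1 + 1 / y) * (X - ln X)"
  proof -
    have "(1 + 1 / y) * (y\<^sup>2 - y * (8 / 10)) = y\<^sup>2 + y * (2 / 10) - 8 / 10"
      using y by (simp add: field_simps power2_eq_square)
    then have "X \<le> (1 + 1 / y) * (y\<^sup>2 - y * (8 / 10))"
      using y by simp
    also have "\<dots> \<le> (1 + 1 / y) * (X - ln X)"
      using y lnX by (intro mult_left_mono) auto
    finally show ?thesis .
  qed
  also have "\<dots> \<le> (1 + \<theta>) * ln N"
  proof (rule mult_mono)
    show "1 + 1 / y \<le> 1 + \<theta>" using \<theta>_ge by (simp add: y_def)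
    have "y * (8 / 10) \<le> y * y" using y by (intro mult_left_mono) auto
    then show "0 \<le> X - ln X" using lnX by (simp add: power2_eq_square flip: y(2))
  qed (use lower \<theta>_pos in auto)
  finally show "X \<le> (1 + \<theta>) * ln N" .
  have "real N \<le> N0" by (rule N_bounds)
  also have "N0 \<le> 2 * H / X"
    unfolding N0_def using b\<theta> X_ge by (intro divide_right_mono mult_right_mono) (auto simp: H)
  also have "\<dots> \<le> H" using X_ge by (simp add: H field_simps)
  finally have "ln N \<le> ln H" using N_pos by (subst ln_le_cancel_iff) (auto simp: H)
  then show "ln N \<le> X" by (simp add: H)
  have "exp 1 \<le> real N" using exp_le N_pos by linarith
  then show "ln N \<ge> 1" using N_pos by (subst ln_ge_iff) auto
qed

text \<open>From \<open>N \<ge> X ^ 3\<close> and \<open>\<theta> \<ge> 1 / X\<close> one gets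
  \<open>N * \<theta> \<ge> X\<^sup>2\<close>, which is at least 10201 * m^4.\<close>

lemma error_terms: "real m + 1 + real m ^ 3 + real m * ln (4 * real m) \<le> N * (\<theta> / 100)"
  "1 \<le> N * (\<theta> / 100)"
proof -
  have X\<theta>: "X\<^sup>2 \<le> N * \<theta>"
  proof -
    have "1 / X \<le> \<theta>"
    proof -
      have "sqrt X \<le> X" using X_ge by (intro real_le_lsqrt) (auto simp: power2_eq_square)
      then have "1 / X \<le> 1 / sqrt X" using X_ge by (intro divide_left_mono) auto
      then show ?thesis using \<theta>_ge by linarith
    qed
    then have "X ^ 3 * (1 / X) \<le> N * \<theta>"
      using N_bounds X_ge by (intro mult_mono) auto
    then show ?thesis using X_ge by (simp add: eval_nat_numeral)
  qed
  have "404 * 404 \<le> X * X" using X_ge by (intro mult_mono) auto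
  then show "1 \<le> N * (\<theta> / 100)" using X\<theta> by (simp add: power2_eq_square)
  have m2: "real m \<ge> 2" using m by simp
  have "ln (4 * real m) \<le> 4 * real m - 1" using m by (intro ln_le_minus_one) auto
  then have "real m * ln (4 * real m) \<le> real m * (4 * real m)"
    using m by (intro mult_left_mono) auto
  also have "\<dots> \<le> real m * (real m * (2 * real m))"
    using m2 by (intro mult_left_mono) auto
  finally have "real m * ln (4 * real m) \<le> 2 * real m ^ 3" by (simp add: eval_nat_numeral)
  moreover have "real m + 1 \<le> real m ^ 3"
  proof -
    have "2 * 2 * real m \<le> real m * real m * real m"
      using m2 by (intro mult_right_mono mult_mono) auto
    then show ?thesis using m2 unfolding power3_eq_cube by linarith
  qed
  moreover have "4 * real m ^ 3 \<le> X\<^sup>2 / 100"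
  proof -
    have m34: "real m ^ 3 \<le> real m ^ 4" using m2 by (intro power_increasing) auto
    have "101 * (real m)\<^sup>2 * (101 * (real m)\<^sup>2) \<le> X * X"
      using X_ge by (intro mult_mono) auto
    then have "10201 * real m ^ 4 \<le> X\<^sup>2" by (simp add: eval_nat_numeral)
    moreover have "0 \<le> real m ^ 3" by simp
    ultimately show ?thesis using m34 by linarith
  qed
  ultimately show "real m + 1 + real m ^ 3 + real m * ln (4 * real m) \<le> N * (\<theta> / 100)"
    using X\<theta> by simp
qed

text \<open>
  The summands stem from differentiation and the free coefficients, rounding, the size of the
  auxiliary coefficients, and the heights; \<open>q * \<theta> * N\<close> bounds all but the last.
\<close>
lemma main_inequality:
  "(real m + 1) * (3 / 2 * \<theta> * N + 1) + real m ^ 3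
     + (real m * ln (4 * real m) + real m * (4 / 3 * \<theta> * X * N) + H) / ln N \<le> N"
proof -
  \<comment> \<open>The sum 3/2 * (m + 1) + 4/3 * m is 17/6 * m + 3/2; the spare 1/6 covers 1/100
    and 4/3 * (m * \<theta>), the latter at most 4/27.\<close>
  define q where "q = 17 / 6 * real m + 5 / 3"
  define l where "l = ln (real N)"
  have l: "X \<le> (1 + \<theta>) * l" "l \<le> X" "l \<ge> 1" using ln_N by (auto simp: l_def)
  have m2: "real m \<ge> 2" using m by simp
  have "real m * ln (4 * real m) / l \<le> real m * ln (4 * real m) / 1"
    using l m by (intro divide_left_mono) auto
  moreover have "real m * (4 / 3 * \<theta> * X * N) / l \<le> real m * (4 / 3 * \<theta> * N) * (1 + \<theta>)"
  proof -
    have "real m * (4 / 3 * \<theta> * X * N) = real m * (4 / 3 * \<theta> * N) * X" by simp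
    also have "\<dots> \<le> real m * (4 / 3 * \<theta> * N) * ((1 + \<theta>) * l)"
      using l \<theta>_pos by (intro mult_left_mono) auto
    finally show ?thesis using l by (simp add: divide_le_eq mult.assoc)
  qed
  \<comment> \<open>After inserting the definition of \<open>N0\<close> and
    \<open>X \<le> (1 + \<theta>) * l\<close>, the claim reduces to \<open>(1 + \<theta>/100) * (1 +
    \<theta>) \<le> (1 + b * \<theta>) * (1 - q * \<theta>)\<close>, where
    \<open>\<theta>/100\<close> pays for rounding \<open>N0\<close>.\<close>
  moreover have "H / l \<le> N * (1 - q * \<theta>)"
  proof -
    have pos: "1 + b * \<theta> > 0" using b\<theta> by simp
    have "(1 + b * \<theta>) * H = N0 * X" using X_ge by (simp add: N0_def)
    also have "\<dots> \<le> (N + N * (\<theta> / 100)) * X"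
      using N_bounds error_terms X_ge by (intro mult_right_mono) auto
    also have "\<dots> \<le> (N + N * (\<theta> / 100)) * ((1 + \<theta>) * l)"
      using l \<theta>_pos by (intro mult_left_mono) auto
    also have "\<dots> = N * l * ((1 + \<theta> / 100) * (1 + \<theta>))" by (simp add: algebra_simps)
    also have "\<dots> \<le> N * l * ((1 + b * \<theta>) * (1 - q * \<theta>))"
    proof (intro mult_left_mono)
      have bq: "b * (q * \<theta>) \<le> (7 + 1 / m) * (17 / 6 * real m + 5 / 3) / 9"
      proof -
        have "b * (q * \<theta>) = (7 + 1 / m) * q * (real m * \<theta>)"
          using m by (simp add: b_def field_simps)
        also have "\<dots> \<le> (7 + 1 / m) * q * (1 / 9)"
          using m\<theta>_le by (intro mult_left_mono) (auto simp: q_def)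
        finally show ?thesis by (simp add: q_def)
      qed
      also have "\<dots> = (119 / 6 * real m + 29 / 2 + 5 / 3 / real m) / 9"
        using m by (simp add: field_simps)
      also have "\<dots> \<le> (119 / 6 * real m + 29 / 2 + 5 / 6) / 9"
        using m2 by (simp add: field_simps)
      finally have "101 / 100 + \<theta> / 100 + q + b * (q * \<theta>) \<le> b"
        using m2 \<theta>_le by (simp add: q_def b_def)
      then have "(101 / 100 + \<theta> / 100 + q + b * (q * \<theta>)) * \<theta> \<le> b * \<theta>"
        using \<theta>_pos by (intro mult_right_mono) auto
      then show "(1 + \<theta> / 100) * (1 + \<theta>) \<le> (1 + b * \<theta>) * (1 - q * \<theta>)"
        by (simp add: algebra_simps add_divide_distrib)
    qed (use l in auto)
    also have "\<dots> = (1 + b * \<theta>) * (N * (1 - q * \<theta>) * l)" by (simp add: algebra_simps)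
    finally have "H \<le> N * (1 - q * \<theta>) * l" using pos by simp
    then show ?thesis using l by (simp add: divide_le_eq)
  qed
  moreover have "N * \<theta> * (3 / 2 * (real m + 1) + 1 / 100 + 4 / 3 * real m + 4 / 3 * (real m * \<theta>)) \<le> N * \<theta> * q"
    proof (rule mult_left_mono)
    have "3 / 2 * (M + 1) + 1 / 100 + 4 / 3 * M + 4 / 3 * z \<le> 17 / 6 * M + 5 / 3"
      if "z \<le> 1 / 9" for M z :: real
      using that by (simp add: field_simps)
    then show "3 / 2 * (real m + 1) + 1 / 100 + 4 / 3 * real m + 4 / 3 * (real m * \<theta>) \<le> q"
      using m\<theta>_le unfolding q_def by blast
  qed (use \<theta>_pos in simp)
  moreover have "(real m + 1) * (3 / 2 * \<theta> * N + 1) = N * \<theta> * (3 / 2 * (real m + 1)) + (real m + 1)"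
    "real m * (4 / 3 * \<theta> * N) * (1 + \<theta>) = N * \<theta> * (4 / 3 * real m + 4 / 3 * (real m * \<theta>))"
    "N * (1 - q * \<theta>) = N - N * \<theta> * q"
    "N * \<theta> * (3 / 2 * (real m + 1) + 1 / 100 + 4 / 3 * real m + 4 / 3 * (real m * \<theta>)) =
      N * \<theta> * (3 / 2 * (real m + 1)) + N * (\<theta> / 100) + N * \<theta> * (4 / 3 * real m + 4 / 3 * (real m * \<theta>))"
    by (simp_all add: algebra_simps)
  ultimately show ?thesis
    using error_terms(1) unfolding l_def[symmetric] add_divide_distrib by linarith
qed

text \<open>Because \<open>lam = \<theta>\<^sup>2 * X\<close>, the cost of Siegel's lemma is 4/3 *
  \<theta> * N * X minus \<open>2 * N * lam\<close>, and the subtracted term swallows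
  \<open>ln 6\<close>. Then \<open>N * X \<le> (1 + b * \<theta>) * H\<close> finishes.\<close>

lemma final_inequality:
  "ln 6 + 2 * N * lam * (1 / (3 / 2 * \<theta>) - 1) + N * ln N < (1 + (4 + 7 * real m) * \<theta>) * H"
proof -
  have m2: "real m \<ge> 2" using m by simp
  have "lam = \<theta> * \<theta> * X" using \<theta>_sq X_ge by (simp add: field_simps power2_eq_square)
  then have A: "2 * N * lam * (1 / (3 / 2 * \<theta>) - 1) = 4 / 3 * \<theta> * (N * X) - 2 * N * lam"
    using \<theta>_pos by (simp add: field_simps)
  have NX: "N * X \<le> (1 + b * \<theta>) * H"
  proof -
    have "N * X \<le> N0 * X" using N_bounds X_ge by (intro mult_right_mono) auto
    then show ?thesis using X_ge by (simp add: N0_def)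
  qed
  moreover from NX have "4 / 3 * \<theta> * (N * X) \<le> 4 / 3 * \<theta> * ((1 + b * \<theta>) * H)"
    using \<theta>_pos by (intro mult_left_mono) auto
  moreover have "N * ln N \<le> N * X" using ln_N by (intro mult_left_mono) auto
  moreover have "ln 6 \<le> 2 * N * lam"
  proof -
    have "ln (6 :: real) \<le> 5" using ln_le_minus_one[of "6 :: real"] by simp
    also have "\<dots> \<le> 2 * real N * 1" using N_pos by simp
    also have "\<dots> \<le> 2 * N * lam" using mult_left_mono[OF lam_ge_1, of "2 * real N"] by simp
    finally show ?thesis .
  qed
  ultimately have "ln 6 + 2 * N * lam * (1 / (3 / 2 * \<theta>) - 1) + N * ln N \<le> (1 + b * \<theta>) * H + 4 / 3 * \<theta> * ((1 + b * \<theta>) * H)"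
    unfolding A using NX by linarith
  also have "\<dots> = (1 + (b + 4 / 3 + 4 / 3 * (b * \<theta>)) * \<theta>) * H" by (simp add: algebra_simps)
  also have "\<dots> < (1 + (4 + 7 * real m) * \<theta>) * H"
  proof (intro mult_strict_right_mono add_strict_left_mono)
    show "b + 4 / 3 + 4 / 3 * (b * \<theta>) < 4 + 7 * real m"
      using m\<theta>_le \<theta>_le by (simp add: b_def algebra_simps)
  qed (use \<theta>_pos in \<open>auto simp: H\<close>)
  finally show ?thesis .
qed

end

lemma exists_parameters:
  fixes h :: "nat \<Rightarrow> real"
  assumes m: "m \<ge> 2" and h: "\<And>j. j \<in> {1..m} \<Longrightarrow> h j \<ge> 1"
    and H_eq: "H = ln (\<Prod>j=1..m. h j)"
    and large: "H \<ge> (real m)\<^sup>2 * (41 * ln (real m + 1) + 10)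
                 * exp ((real m)\<^sup>2 * (81 * ln (real m + 1) + 20))"
  obtains N B k \<nu> where "N \<ge> 2 * (m + 1)" "\<And>j. j \<in> {1..m} \<Longrightarrow> \<nu> j < N" "(\<Sum>j=1..m. \<nu> j) \<le> N"
    "((m + 1) ^ (2 * N)) ^ (\<Sum>j=1..m. \<nu> j) < (B + 1) ^ (N + 1 - (\<Sum>j=1..m. \<nu> j))"
    "N + m\<^sup>2 \<le> k + (\<Sum>j=1..m. \<nu> j)" "\<And>j. j \<in> {1..m} \<Longrightarrow> k \<le> \<nu> j"
    "\<And>j. j \<in> {1..m} \<Longrightarrow> 4 * real m * real B * (real m + 1) ^ (2 * N) * h j \<le> real N ^ (\<nu> j - k + 1)"
    "6 * real B * fact N < exp ((1 + (4 + 7 * real m) * sqrt (ln (real m + 1) / ln H)) * H)"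
proof -
  define lam where "lam = ln (real m + 1)"
  define X where "X = ln H"
  define \<theta> where "\<theta> = sqrt (lam / X)"
  have "lam \<ge> 0" by (simp add: lam_def)
  have "(real m)\<^sup>2 \<ge> 1\<^sup>2" using m by (intro power_mono) auto
  then have "1 * 1 \<le> (real m)\<^sup>2 * (41 * lam + 10)"
    using \<open>lam \<ge> 0\<close> by (intro mult_mono) auto
  then have "1 * exp ((real m)\<^sup>2 * (81 * lam + 20)) \<le> (real m)\<^sup>2 * (41 * lam + 10) * exp ((real m)\<^sup>2 * (81 * lam + 20))"
    by (intro mult_right_mono) auto
  also have "\<dots> \<le> H" using large by (simp only: lam_def)
  finally have exp_le: "exp ((real m)\<^sup>2 * (81 * lam + 20)) \<le> H" by simp
  then have H_pos: "H > 0" by (rule less_le_trans[OF exp_gt_zero])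
  have "(real m)\<^sup>2 * (81 * lam + 20) \<le> X"
    using exp_le H_pos by (simp add: X_def ln_ge_iff)
  then interpret parameters m H X lam \<theta>
    using m H_pos by unfold_locales (simp_all add: X_def lam_def \<theta>_def)
  \<comment> \<open>Minimising \<gamma> + 2 * lam / (\<gamma> * X) would give \<gamma> = sqrt 2 *
    \<theta>; 3/2 is a convenient rational nearby.\<close>
  define \<gamma> where "\<gamma> = 3 / 2 * \<theta>"
  have \<gamma>: "\<gamma> > 0" "\<gamma> < 1" using \<theta>_pos \<theta>_le by (auto simp: \<gamma>_def)
  define \<kappa> where "\<kappa> = nat \<lceil>\<gamma> * N\<rceil>"
  have \<kappa>: "\<gamma> * N \<le> \<kappa>" "\<kappa> \<le> \<gamma> * N + 1" "\<kappa> \<ge> 1"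
  proof -
    have pos: "\<gamma> * N > 0" using \<gamma> N_pos by simp
    then show "\<gamma> * N \<le> \<kappa>" "\<kappa> \<le> \<gamma> * N + 1" unfolding \<kappa>_def by linarith+
    with pos show "\<kappa> \<ge> 1" by (cases \<kappa>) auto
  qed
  \<comment> \<open>With gaps of total length \<open>N - \<kappa>\<close>, this is the number of
    derivatives that the zero estimate asks for.\<close>
  define k where "k = \<kappa> + m\<^sup>2"
  \<comment> \<open>\<open>exp D\<close> bounds \<open>4 * m * B * (m + 1) ^ (2 * N)\<close>: the
    \<open>- 1\<close> in the exponent of \<open>B\<close> makes room for the last factor. Hence
    \<open>x j\<close> solves N^(x j) = exp D * h j.\<close>
  define D where "D = ln (4 * real m) + 2 * N * lam / \<gamma>"
  define x where "x = (\<lambda>j. (D + ln (h j)) / ln N)"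
  define B where "B = nat \<lfloor>exp (2 * N * lam * (1 / \<gamma> - 1))\<rfloor>"
  have D: "D \<ge> 0" using m \<gamma> \<open>lam \<ge> 0\<close> by (simp add: D_def)
  have x: "x j \<ge> 0" if "j \<in> {1..m}" for j
    using D h[OF that] ln_N by (simp add: x_def)
  \<comment> \<open>The budget: the gap lengths required by the heights and by \<open>k\<close>
    derivatives, plus the \<open>\<kappa>\<close> positions left free, must fit into
    \<open>N\<close>.\<close>
  have "real ((\<Sum>j=1..m. k + nat \<lfloor>x j\<rfloor>) + \<kappa>) \<le> (\<Sum>j=1..m. real k + x j) + \<kappa>"
    using x by (auto intro!: sum_mono)
  also have "(\<Sum>j=1..m. real k + x j) = m * real k + (m * D + H) / ln N"
  proof -
    have "(\<Sum>j=1..m. ln (h j)) = H"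
    proof -
      have "h j > 0" if "j \<in> {1..m}" for j using h[OF that] by simp
      then show ?thesis unfolding H_eq by (intro ln_prod[symmetric]) fastforce+
    qed
    then show ?thesis
      by (simp add: x_def sum.distrib flip: sum_divide_distrib)
  qed
  also have "m * real k + (m * D + H) / ln N + \<kappa> \<le> N"
  proof -
    have "m * real k + \<kappa> = (real m + 1) * \<kappa> + real m ^ 3"
      by (simp add: k_def algebra_simps power2_eq_square power3_eq_cube)
    also have "\<dots> \<le> (real m + 1) * (3 / 2 * \<theta> * N + 1) + real m ^ 3"
      using \<kappa>(2) by (intro add_right_mono mult_left_mono) (auto simp: \<gamma>_def)
    finally have "m * real k + \<kappa> \<le> (real m + 1) * (3 / 2 * \<theta> * N + 1) + real m ^ 3" .
    moreover have "m * D = real m * ln (4 * real m) + real m * (4 / 3 * \<theta> * X * N)"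
    proof -
      have "lam = \<theta> * \<theta> * X" using \<theta>_sq X_ge by (simp add: field_simps power2_eq_square)
      then have eq: "2 * N * lam / \<gamma> = 4 / 3 * \<theta> * X * N"
        using \<theta>_pos by (simp add: \<gamma>_def field_simps)
      show ?thesis unfolding D_def eq by (simp add: distrib_left)
    qed
    ultimately show ?thesis using main_inequality by simp
  qed
  finally have sum_r: "(\<Sum>j=1..m. k + nat \<lfloor>x j\<rfloor>) + \<kappa> \<le> N"
    by (simp only: of_nat_le_iff)
  then have "(\<Sum>j=1..m. k + nat \<lfloor>x j\<rfloor>) \<le> N - \<kappa>" by linarith
  then obtain \<nu> where \<nu>: "\<And>j. k + nat \<lfloor>x j\<rfloor> \<le> \<nu> j" "(\<Sum>j=1..m. \<nu> j) = N - \<kappa>"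
    using exists_larger_with_sum[of m "\<lambda>j. k + nat \<lfloor>x j\<rfloor>" "N - \<kappa>"] m by fastforce
  have \<kappa>_le: "\<kappa> \<le> N" using sum_r by linarith
  show ?thesis
  proof (rule that[of N \<nu> B k])
    show "2 * (m + 1) \<le> N"
    proof -
      have "real m * 2 \<le> real m * real m" using m by (intro mult_left_mono) auto
      moreover have "X * 1 \<le> X * X\<^sup>2" using X_ge by (intro mult_left_mono) auto
      then have "X \<le> N" using N_bounds(4) by (simp add: eval_nat_numeral)
      ultimately have "real (2 * (m + 1)) \<le> real N"
        using X_ge N_pos by (simp add: power2_eq_square)
      then show ?thesis by (simp only: of_nat_le_iff)
    qed
    show "\<nu> j < N" if "j \<in> {1..m}" for j
    proof -
      have "\<nu> j \<le> (\<Sum>j=1..m. \<nu> j)" using that by (intro member_le_sum) auto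
      then show ?thesis using \<nu>(2) \<kappa>(3) N_pos by linarith
    qed
    show "(\<Sum>j=1..m. \<nu> j) \<le> N" unfolding \<nu>(2) by simp
    show "N + m\<^sup>2 \<le> k + (\<Sum>j=1..m. \<nu> j)" unfolding \<nu>(2) k_def using \<kappa>_le by simp
    show "k \<le> \<nu> j" for j using \<nu>(1)[of j] by simp
    have m_exp: "(real m + 1) ^ n = exp (n * lam)" for n
      by (simp add: lam_def exp_of_nat_mult)
    show "((m + 1) ^ (2 * N)) ^ (\<Sum>j=1..m. \<nu> j) < (B + 1) ^ (N + 1 - (\<Sum>j=1..m. \<nu> j))"
    proof -
      have "real (((m + 1) ^ (2 * N)) ^ (N - \<kappa>)) = exp (2 * N * lam * (real N - \<kappa>))"
        using \<kappa>_le m_exp[of "2 * N * (N - \<kappa>)"] by (simp add: power_mult[symmetric] of_nat_diff add.commute mult_ac)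
      also have "\<dots> \<le> exp (2 * N * lam * ((1 / \<gamma> - 1) * (\<kappa> + 1)))"
      proof -
        \<comment> \<open>The ratio of equations to surplus unknowns is at most
          \<open>1/\<gamma> - 1\<close>, which explains the exponent in \<open>B\<close>.\<close>
        have "\<gamma> * (real N - \<kappa>) \<le> (1 - \<gamma>) * (\<kappa> + 1)"
          using \<kappa>(1) \<gamma> by (simp add: algebra_simps)
        then have "real N - \<kappa> \<le> (1 / \<gamma> - 1) * (\<kappa> + 1)"
          using \<gamma> by (simp add: field_simps)
        then show ?thesis using \<open>lam \<ge> 0\<close> by (simp add: mult_left_mono)
      qed
      also have "\<dots> = exp (2 * N * lam * (1 / \<gamma> - 1)) ^ (\<kappa> + 1)"
        unfolding exp_of_nat_mult[symmetric] by (simp only: mult_ac)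
      also have "\<dots> < (real B + 1) ^ (\<kappa> + 1)"
      proof (rule power_strict_mono)
        show "exp (2 * N * lam * (1 / \<gamma> - 1)) < real B + 1"
          unfolding B_def by linarith
      qed simp_all
      also have "\<dots> = real ((B + 1) ^ (\<kappa> + 1))"
        by (simp only: of_nat_power of_nat_add of_nat_1)
      finally have "((m + 1) ^ (2 * N)) ^ (N - \<kappa>) < (B + 1) ^ (\<kappa> + 1)"
        by (simp only: of_nat_less_iff)
      moreover have "N + 1 - (N - \<kappa>) = \<kappa> + 1" using \<kappa>_le by simp
      ultimately show ?thesis by (simp only: \<nu>(2))
    qed
    have B: "real B \<le> exp (2 * N * lam * (1 / \<gamma> - 1))"
      unfolding B_def by (simp add: of_nat_nat)
    show "4 * real m * real B * (real m + 1) ^ (2 * N) * h j \<le> real N ^ (\<nu> j - k + 1)"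
      if j: "j \<in> {1..m}" for j
    proof -
      have hj: "h j > 0" using h[OF j] by simp
      have "4 * real m * real B * (real m + 1) ^ (2 * N) * h j \<le>
          4 * real m * exp (2 * N * lam * (1 / \<gamma> - 1)) * exp ((2 * N) * lam) * h j"
        unfolding m_exp using B hj by (intro mult_right_mono mult_left_mono) auto
      also have "\<dots> = exp (D + ln (h j))"
      proof -
        have D_eq: "D + ln (h j) = ln (4 * real m) + 2 * N * lam * (1 / \<gamma> - 1) + 2 * N * lam + ln (h j)"
          by (simp add: D_def right_diff_distrib)
        show ?thesis
          unfolding D_eq exp_add using m hj by simp
      qed
      also have "D + ln (h j) \<le> real (\<nu> j - k + 1) * ln N"
      proof -
        \<comment> \<open>The \<open>+ 1\<close> in the exponent of \<open>N\<close>, from the first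
          term after the gap, makes up for rounding \<open>x j\<close> down.\<close>
        have "x j \<le> real (nat \<lfloor>x j\<rfloor>) + 1" by linarith
        also have "\<dots> \<le> real (\<nu> j - k + 1)" using \<nu>(1)[of j] by simp
        finally show ?thesis using ln_N by (simp add: x_def field_simps)
      qed
      then have "exp (D + ln (h j)) \<le> exp (real (\<nu> j - k + 1) * ln N)" by simp
      also have "\<dots> = real N ^ (\<nu> j - k + 1)"
        using N_pos by (simp only: exp_of_nat_mult) simp
      finally show ?thesis .
    qed
    have "6 * real B * fact N \<le> 6 * exp (2 * N * lam * (1 / \<gamma> - 1)) * real N ^ N"
      using B fact_le_power[of N, where 'a = real] by (intro mult_mono) auto
    also have "real N ^ N = exp (N * ln N)"
      using N_pos by (simp add: exp_of_nat_mult)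
    also have "6 * exp (2 * N * lam * (1 / \<gamma> - 1)) * exp (N * ln N) =
        exp (ln 6 + 2 * N * lam * (1 / \<gamma> - 1) + N * ln N)"
      by (simp add: exp_add)
    also have "\<dots> < exp ((1 + (4 + 7 * real m) * \<theta>) * H)"
      using final_inequality by (simp add: \<gamma>_def)
    finally show "6 * real B * fact N < exp ((1 + (4 + 7 * real m) * sqrt (ln (real m + 1) / ln H)) * H)"
      by (simp add: \<theta>_def X_def lam_def)
  qed
qed

theorem mainTheorem1:
  fixes K :: "complex set" and m :: nat and \<beta> :: "nat \<Rightarrow> complex" and h :: real
  assumes "K = \<rat> \<or> imaginary_quadratic_field K"
    and "m \<ge> 2"
    and "\<forall>i\<le>m. \<beta> i \<in> ring_of_integers K"
    and "\<exists>i\<le>m. \<beta> i \<noteq> 0"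
    and "h = height m \<beta>"
    and "ln h \<ge> (real m)\<^sup>2 * (41 * ln (real m + 1) + 10)
                 * exp ((real m)\<^sup>2 * (81 * ln (real m + 1) + 20))"
  shows "cmod (\<Sum>i=0..m. \<beta> i * exp 1 ^ i) > 1 / h powr (1 + epsilon_hat m h)"
proof -
  have "ln h = ln (\<Prod>j=1..m. max 1 (cmod (\<beta> j)))"
    using assms(5) by (simp add: height_def)
  from exists_parameters[OF assms(2) _ this assms(6)]
  obtain N B k \<nu> where p: "N \<ge> 2 * (m + 1)" "\<And>j. j \<in> {1..m} \<Longrightarrow> \<nu> j < N" "(\<Sum>j=1..m. \<nu> j) \<le> N"
    "((m + 1) ^ (2 * N)) ^ (\<Sum>j=1..m. \<nu> j) < (B + 1) ^ (N + 1 - (\<Sum>j=1..m. \<nu> j))"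
    "N + m\<^sup>2 \<le> k + (\<Sum>j=1..m. \<nu> j)" "\<And>j. j \<in> {1..m} \<Longrightarrow> k \<le> \<nu> j"
    "\<And>j. j \<in> {1..m} \<Longrightarrow>
      4 * real m * real B * (real m + 1) ^ (2 * N) * max 1 (cmod (\<beta> j)) \<le> real N ^ (\<nu> j - k + 1)"
    and upper: "6 * real B * fact N < exp ((1 + (4 + 7 * real m) * sqrt (ln (real m + 1) / ln (ln h))) * ln h)"
    by (metis max.cobounded1)
  have "h > 0"
    unfolding assms(5) height_def by (intro prod_pos) auto
  then have "exp ((1 + (4 + 7 * real m) * sqrt (ln (real m + 1) / ln (ln h))) * ln h) = h powr (1 + epsilon_hat m h)"
    by (simp add: powr_def epsilon_hat_def real_sqrt_divide)
  with upper have upper': "6 * real B * fact N < h powr (1 + epsilon_hat m h)" by simp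
  have "B > 0"
  proof (rule ccontr)
    assume "\<not> B > 0"
    then have "((m + 1) ^ (2 * N)) ^ (\<Sum>j=1..m. \<nu> j) < 1"
      using p(4) by simp
    then show False by simp
  qed
  then have "1 / h powr (1 + epsilon_hat m h) < 1 / (6 * real B * fact N)"
    using upper' \<open>h > 0\<close> by (intro divide_strict_left_mono) auto
  also have "\<dots> \<le> cmod (\<Sum>i\<le>m. \<beta> i * exp (of_nat i))"
    by (rule cmod_lower_bound_of_parameters[OF assms(1,3,4) p])
  also have "(\<Sum>i\<le>m. \<beta> i * exp (of_nat i)) = (\<Sum>i=0..m. \<beta> i * exp 1 ^ i)"
    by (simp add: atMost_atLeast0 exp_of_nat_mult[of _ 1, simplified])
  finally show ?thesis .
qed

end
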